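(* Let $\nu>0$, $\alpha>\frac32$, and $\Phi_m(r)=r^{-\alpha}$ for all $m\in\mathbb{N}$. For each $\delta\in(0,1)$ let $W_\delta\in\mathcal{C}$ be a function with $\mathcal{K}(W_\delta)=(1-\delta)\frac{\nu^2}{2}$ and $\mathcal{P}(W_\delta)=P\big((1-\delta)\frac{\nu^2}{2}\big)$ (a maximizer), and let $c_\delta:=\mu(W_\delta)^{-1/2}$ be its wave speed. Let $W_0:=\nu\,\chi_{[-1/2,1/2]}$. Then $W_\delta\to W_0$ strongly in $\mathsf{L}^2(\mathbb{R})$ and $c_\delta^2\to\infty$ as $\delta\to0$.
   Context: $A_m f(\xi):=\int_{-m/2}^{m/2} f(\xi+s)\,ds$. $\Psi_m(r):=\Phi_m(\nu m-r)-\Phi_m(\nu m)+\Phi_m'(\nu m)r=(\nu m-r)^{-\alpha}-(\nu m)^{-\alpha}-\alpha(\nu m)^{-\alpha-1}r$ for $r\in[0,\nu m)$. $\mathcal{P}(W):=\int_{\mathbb{R}}\sum_{m\ge1}\Psi_m(A_mW(s))\,ds$, $\mathcal{K}(W):=\frac12\int_{\mathbb{R}}W^2$, $\partial\mathcal{P}(W):=\sum_{m\ge1}A_m\Psi_m'(A_mW)$, $\mu(W):=\|W\|_2/\|\partial\mathcal{P}(W)\|_2$. $\mathcal{C}$ is the $\mathsf{L}^2(\mathbb{R})$-closure of $\{W\in C_c^\infty(\mathbb{R}): W(x)=W(-x)\ge0,\ \dot W(x)=-\dot W(-x)\le0\ \forall x\ge0\}$; for $0<K<\nu^2/2$, $\mathcal{C}_K:=\{W\in\mathcal{C}:\mathcal{K}(W)=K\}$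 and $P(K):=\sup_{W\in\mathcal{C}_K}\mathcal{P}(W)$. A maximizer $W_\delta$ satisfies $W_\delta=\mu(W_\delta)\partial\mathcal{P}(W_\delta)$, i.e. it solves $c_\delta^2W=\sum_{m\ge1}A_m(-\Phi_m'(\nu m-A_mW))+\eta$ with $c_\delta=\mu(W_\delta)^{-1/2}$. *)

theory Defs
  imports "HOL-Analysis.Analysis"
begin

definition Aop :: "nat \<Rightarrow> (real \<Rightarrow> real) \<Rightarrow> real \<Rightarrow> real" where
  "Aop m f \<xi> = (LBINT s:{-(real m/2)..real m/2}. f (\<xi> + s))"

definition Psi :: "real \<Rightarrow> real \<Rightarrow> nat \<Rightarrow> real \<Rightarrow> real" where
  "Psi \<nu> \<alpha> m r = (\<nu> * real m - r) powr (-\<alpha>) - (\<nu> * real m) powr (-\<alpha>)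
                     - \<alpha> * (\<nu> * real m) powr (-\<alpha> - 1) * r"

definition dPsi :: "real \<Rightarrow> real \<Rightarrow> nat \<Rightarrow> real \<Rightarrow> real" where
  "dPsi \<nu> \<alpha> m r = \<alpha> * (\<nu> * real m - r) powr (-\<alpha> - 1) - \<alpha> * (\<nu> * real m) powr (-\<alpha> - 1)"

definition Pot :: "real \<Rightarrow> real \<Rightarrow> (real \<Rightarrow> real) \<Rightarrow> real" where
  "Pot \<nu> \<alpha> W = (\<integral>s. (\<Sum>m. Psi \<nu> \<alpha> (Suc m) (Aop (Suc m) W s)) \<partial>lborel)"

definition Kin :: "(real \<Rightarrow> real) \<Rightarrow> real" where
  "Kin W = (1/2) * (\<integral>x. (W x)\<^sup>2 \<partial>lborel)"

definition L2norm :: "(real \<Rightarrow> real) \<Rightarrow> real" where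
  "L2norm W = sqrt (\<integral>x. (W x)\<^sup>2 \<partial>lborel)"

definition is_L2 :: "(real \<Rightarrow> real) \<Rightarrow> bool" where
  "is_L2 W \<longleftrightarrow> W \<in> borel_measurable lborel \<and> integrable lborel (\<lambda>x. (W x)\<^sup>2)"

definition dPot :: "real \<Rightarrow> real \<Rightarrow> (real \<Rightarrow> real) \<Rightarrow> real \<Rightarrow> real" where
  "dPot \<nu> \<alpha> W \<xi> = (\<Sum>m. Aop (Suc m) (\<lambda>s. dPsi \<nu> \<alpha> (Suc m) (Aop (Suc m) W s)) \<xi>)"

definition mu :: "real \<Rightarrow> real \<Rightarrow> (real \<Rightarrow> real) \<Rightarrow> real" where
  "mu \<nu> \<alpha> W = L2norm W / L2norm (dPot \<nu> \<alpha> W)"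

definition smooth :: "(real \<Rightarrow> real) \<Rightarrow> bool" where
  "smooth W \<longleftrightarrow> (\<forall>k x. ((deriv ^^ k) W) differentiable (at x))"

definition compact_support :: "(real \<Rightarrow> real) \<Rightarrow> bool" where
  "compact_support W \<longleftrightarrow> compact (closure {x. W x \<noteq> 0})"

definition C0 :: "(real \<Rightarrow> real) set" where
  "C0 = {W. smooth W \<and> compact_support W \<and>
           (\<forall>x\<ge>0. W x = W (-x) \<and> W x \<ge> 0 \<and>
                   deriv W x = - deriv W (-x) \<and> deriv W x \<le> 0)}"

definition Ccone :: "(real \<Rightarrow> real) set" where
  "Ccone = {W. is_L2 W \<and> (\<exists>\<phi>::nat \<Rightarrow> real \<Rightarrow> real. (\<forall>n. \<phi> n \<in> C0) \<and>
                (\<lambda>n. L2norm (\<lambda>x. \<phi> n x - W x)) \<longlonglongrightarrow> 0)}"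

definition CK :: "real \<Rightarrow> (real \<Rightarrow> real) set" where
  "CK K = {W \<in> Ccone. Kin W = K}"

definition Pmax :: "real \<Rightarrow> real \<Rightarrow> real \<Rightarrow> real" where
  "Pmax \<nu> \<alpha> K = (SUP W\<in>CK K. Pot \<nu> \<alpha> W)"

end

theory Submission
  imports Defs "HOL-Computational_Algebra.Polynomial" "HOL-Real_Asymp.Real_Asymp"
begin

text \<open>By Cauchy--Schwarz \<open>A\<^sub>m W \<le> \<surd>m \<parallel>W\<parallel>\<close>, so for \<open>\<parallel>W\<parallel> < \<nu>\<close> every \<open>\<Psi>\<^sub>m\<close> is evaluated below its
  singularity, uniformly so for \<open>m \<ge> 2\<close>, and \<open>P\<close> is finite. The competitor \<open>\<surd>(1-\<delta>) W\<^sub>0\<close> has energy of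
  order \<open>\<delta>\<^bsup>1-\<alpha>\<^esup>\<close>, so the energy of the maximizers tends to infinity. This is only possible if
  \<open>sup A\<^sub>1 W\<^sub>\<delta> = A\<^sub>1 W\<^sub>\<delta> (0) \<rightarrow> \<nu>\<close>, and strong convergence follows from
  \<open>\<parallel>W - W\<^sub>0\<parallel>\<^sup>2 = \<parallel>W\<parallel>\<^sup>2 - 2 \<nu> A\<^sub>1 W (0) + \<nu>\<^sup>2\<close>. Conversely, if \<open>\<parallel>W - W\<^sub>0\<parallel> \<le> e\<close> then
  \<open>A\<^sub>1 W \<ge> \<nu> - (\<nu> + 1) e\<close> on \<open>[-e, e]\<close>, so \<open>A\<^sub>1 \<Psi>\<^sub>1'(A\<^sub>1 W)\<close> is at least of order \<open>e\<^bsup>-\<alpha>\<^esup>\<close> on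
  \<open>[-1/4, 1/4]\<close>, which makes the norm of \<open>\<partial>P(W\<^sub>\<delta>)\<close>, and with it \<open>c\<^sub>\<delta>\<^sup>2\<close>, unbounded.\<close>

section \<open>Square-integrable functions and the averaging operators\<close>

lemma integrable_indicator_Icc [simp, intro]: "integrable lborel (indicator {a..b::real} :: real \<Rightarrow> real)"
  by (rule integrable_real_indicator) (auto simp: emeasure_lborel_Icc_eq)

text \<open>Domination by \<open>1 + f^2\<close>, as the constant 1 is integrable over a bounded
  interval.\<close>

lemma is_L2_set_integrable:
  assumes "is_L2 f"
  shows "set_integrable lborel {a..b::real} f"
proof -
  have m: "f \<in> borel_measurable lborel" and i: "integrable lborel (\<lambda>x. (f x)\<^sup>2)"
    using assms by (auto simp: is_L2_def)
  have "integrable lborel (\<lambda>x. indicator {a..b} x + (f x)\<^sup>2)"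
    by (intro Bochner_Integration.integrable_add i integrable_indicator_Icc)
  then show ?thesis unfolding set_integrable_def
  proof (rule Bochner_Integration.integrable_bound)
    show "AE x in lborel. norm (indicator {a..b} x *\<^sub>R f x) \<le> norm (indicator {a..b} x + (f x)\<^sup>2)"
    proof (rule AE_I2)
      fix x
      have "0 \<le> (\<bar>f x\<bar> - 1)\<^sup>2 + (f x)\<^sup>2 + 1" by simp
      then have "\<bar>f x\<bar> \<le> 1 + (f x)\<^sup>2" by (simp add: power2_diff)
      then show "norm (indicator {a..b} x *\<^sub>R f x) \<le> norm (indicator {a..b} x + (f x)\<^sup>2)"
        by (auto simp: indicator_def)
    qed
  qed (use m in measurable)
qed

lemma is_L2_diff:
  assumes "is_L2 f" "is_L2 g"
  shows "is_L2 (\<lambda>x. f x - g x)"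
proof -
  have m: "f \<in> borel_measurable lborel" "g \<in> borel_measurable lborel"
    and i: "integrable lborel (\<lambda>x. (f x)\<^sup>2)" "integrable lborel (\<lambda>x. (g x)\<^sup>2)"
    using assms by (auto simp: is_L2_def)
  have "integrable lborel (\<lambda>x. 2 * (f x)\<^sup>2 + 2 * (g x)\<^sup>2)"
    using i by simp
  then have "integrable lborel (\<lambda>x. (f x - g x)\<^sup>2)"
  proof (rule Bochner_Integration.integrable_bound)
    show "AE x in lborel. norm ((f x - g x)\<^sup>2) \<le> norm (2 * (f x)\<^sup>2 + 2 * (g x)\<^sup>2)"
    proof (rule AE_I2)
      fix x
      have "(f x - g x)\<^sup>2 = 2 * (f x)\<^sup>2 + 2 * (g x)\<^sup>2 - (f x + g x)\<^sup>2"
        by (simp add: power2_eq_square algebra_simps)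
      also have "\<dots> \<le> 2 * (f x)\<^sup>2 + 2 * (g x)\<^sup>2" by simp
      finally show "norm ((f x - g x)\<^sup>2) \<le> norm (2 * (f x)\<^sup>2 + 2 * (g x)\<^sup>2)"
        unfolding real_norm_def abs_power2 by (rule order_trans[OF _ abs_ge_self])
    qed
  qed (use m in measurable)
  with m show ?thesis by (simp add: is_L2_def)
qed

lemma L2norm_nonneg [simp]: "0 \<le> L2norm f"
  by (simp add: L2norm_def)

lemma L2norm_power2: "(L2norm f)\<^sup>2 = (\<integral>x. (f x)\<^sup>2 \<partial>lborel)"
  by (simp add: L2norm_def)

text \<open>Translation moves \<open>\<xi>\<close> from the integrand to the window, so that
  averages can be compared through indicators of intervals.\<close>

lemma Aop_eq: "Aop m f \<xi> = (LBINT x:{\<xi> - real m/2..\<xi> + real m/2}. f x)"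
proof -
  have "(LBINT x:{\<xi> - real m/2..\<xi> + real m/2}. f x)
      = (\<integral>s. indicator {\<xi> - real m/2..\<xi> + real m/2} (\<xi> + s) *\<^sub>R f (\<xi> + s) \<partial>lborel)"
    unfolding set_lebesgue_integral_def
    using lborel_integral_real_affine[of 1 "\<lambda>x. indicator {\<xi> - real m/2..\<xi> + real m/2} x *\<^sub>R f x" \<xi>]
    by simp
  also have "\<dots> = Aop m f \<xi>"
    unfolding Aop_def set_lebesgue_integral_def
    by (intro Bochner_Integration.integral_cong) (auto simp: indicator_def)
  finally show ?thesis by simp
qed

lemma Aop_measurable [measurable]:
  assumes "f \<in> borel_measurable lborel"
  shows "Aop m f \<in> borel_measurable borel"
proof -
  have [measurable]: "f \<in> borel_measurable borel" using assms by simp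
  show ?thesis
    unfolding Aop_def[abs_def] set_lebesgue_integral_def by measurable
qed

lemma Aop_diff:
  assumes "is_L2 f" "is_L2 g"
  shows "Aop m (\<lambda>x. f x - g x) \<xi> = Aop m f \<xi> - Aop m g \<xi>"
  unfolding Aop_eq by (intro set_integral_diff is_L2_set_integrable assms)

lemma Aop_nonneg:
  assumes "\<And>x. 0 \<le> f x"
  shows "0 \<le> Aop m f \<xi>"
  unfolding Aop_def set_lebesgue_integral_def
  by (rule integral_nonneg_AE) (auto simp: indicator_def assms)

text \<open>Cauchy-Schwarz, by expanding a nonnegative variance. The right-hand side stays local to
  the window because it is still to be integrated in \<open>\<xi>\<close>.\<close>

lemma Aop_power2_le_local:
  assumes f: "is_L2 f" and "0 < m"
  shows "(Aop m f \<xi>)\<^sup>2 \<le> real m * (LBINT x:{\<xi> - real m/2..\<xi> + real m/2}. (f x)\<^sup>2)"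
proof -
  let ?I = "{\<xi> - real m/2..\<xi> + real m/2}"
  \<comment> \<open>The mean of \<open>f\<close> over the window, which minimizes the integral of
    \<open>(f - c)^2\<close>.\<close>
  define c where "c = Aop m f \<xi> / real m"
  have m: "f \<in> borel_measurable lborel" and i: "integrable lborel (\<lambda>x. (f x)\<^sup>2)"
    using f by (auto simp: is_L2_def)
  have i1: "set_integrable lborel ?I f" by (rule is_L2_set_integrable[OF f])
  have i2: "set_integrable lborel ?I (\<lambda>x. (f x)\<^sup>2)"
    unfolding set_integrable_def using i by (intro integrable_mult_indicator) auto
  have i3: "set_integrable lborel ?I (\<lambda>x. c\<^sup>2)"
    unfolding set_integrable_def by simp
  have "0 \<le> (LBINT x:?I. (f x - c)\<^sup>2)"
    unfolding set_lebesgue_integral_def by (rule integral_nonneg_AE) auto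
  also have "(LBINT x:?I. (f x - c)\<^sup>2) = (LBINT x:?I. ((f x)\<^sup>2 + c\<^sup>2) - (2 * c) * f x)"
    by (intro set_lebesgue_integral_cong) (auto simp: power2_diff)
  also have "\<dots> = (LBINT x:?I. (f x)\<^sup>2) + (LBINT x:?I. c\<^sup>2) - 2 * c * (LBINT x:?I. f x)"
    using i1 i2 i3 by (simp add: set_integral_add set_integral_diff set_integral_mult_right)
  also have "(LBINT x:?I. c\<^sup>2) = real m * c\<^sup>2"
    by (simp add: set_lebesgue_integral_def)
  finally have "0 \<le> (LBINT x:?I. (f x)\<^sup>2) + real m * c\<^sup>2 - 2 * c * Aop m f \<xi>"
    by (simp add: Aop_eq)
  also have "(LBINT x:?I. (f x)\<^sup>2) + real m * c\<^sup>2 - 2 * c * Aop m f \<xi>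
      = (LBINT x:?I. (f x)\<^sup>2) + (real m * c\<^sup>2 - 2 * c * Aop m f \<xi>)" by simp
  also have "real m * c\<^sup>2 - 2 * c * Aop m f \<xi> = - (Aop m f \<xi>)\<^sup>2 / real m"
    using \<open>0 < m\<close> by (simp add: c_def power2_eq_square field_simps)
  finally have "(Aop m f \<xi>)\<^sup>2 / real m \<le> (LBINT x:?I. (f x)\<^sup>2)" by simp
  then show ?thesis using \<open>0 < m\<close> by (simp add: pos_divide_le_eq mult.commute)
qed

lemma Aop_power2_le:
  assumes f: "is_L2 f" and "0 < m"
  shows "(Aop m f \<xi>)\<^sup>2 \<le> real m * (L2norm f)\<^sup>2"
proof -
  let ?I = "{\<xi> - real m/2..\<xi> + real m/2}"
  have i: "integrable lborel (\<lambda>x. (f x)\<^sup>2)" using f by (auto simp: is_L2_def)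
  have "(LBINT x:?I. (f x)\<^sup>2) \<le> (L2norm f)\<^sup>2"
    unfolding L2norm_power2 set_lebesgue_integral_def
    using i by (intro integral_mono integrable_mult_indicator) (auto simp: indicator_def)
  then have "real m * (LBINT x:?I. (f x)\<^sup>2) \<le> real m * (L2norm f)\<^sup>2"
    by (intro mult_left_mono) auto
  with Aop_power2_le_local[OF assms, of \<xi>] show ?thesis by linarith
qed

lemma Aop_abs_le:
  assumes "is_L2 f" and "0 < m"
  shows "\<bar>Aop m f \<xi>\<bar> \<le> sqrt (real m) * L2norm f"
  using real_sqrt_le_mono[OF Aop_power2_le[OF assms, of \<xi>]]
  by (simp add: real_sqrt_mult)

text \<open>Integrate the local Cauchy-Schwarz bound in \<open>\<xi>\<close> and exchange the
  integrals: each shift \<open>s\<close> contributes the squared norm of \<open>f\<close> by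
  translation invariance, and the window length gives the second factor \<open>m\<close>.
  Nonnegative integrals are used so that integrability comes out as a result.\<close>

lemma Aop_is_L2:
  assumes f: "is_L2 f" and m: "0 < m"
  shows "is_L2 (Aop m f)" and "(L2norm (Aop m f))\<^sup>2 \<le> (real m)\<^sup>2 * (L2norm f)\<^sup>2"
proof -
  have fm: "f \<in> borel_measurable lborel" and i: "integrable lborel (\<lambda>x. (f x)\<^sup>2)"
    using f by (auto simp: is_L2_def)
  have [measurable]: "f \<in> borel_measurable borel" using fm by simp
  have Am: "Aop m f \<in> borel_measurable lborel" using Aop_measurable[OF fm] by simp
  have loc: "ennreal ((Aop m f \<xi>)\<^sup>2)
      \<le> (\<integral>\<^sup>+s. ennreal (real m) * (indicator {-(real m/2)..real m/2} s * ennreal ((f (\<xi> + s))\<^sup>2)) \<partial>lborel)" for \<xi>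
  proof -
    have "(LBINT x:{\<xi> - real m/2..\<xi> + real m/2}. (f x)\<^sup>2) = Aop m (\<lambda>x. (f x)\<^sup>2) \<xi>"
      by (simp add: Aop_eq)
    also have "\<dots> = (\<integral>s. indicator {-(real m/2)..real m/2} s * (f (\<xi> + s))\<^sup>2 \<partial>lborel)"
      by (simp add: Aop_def set_lebesgue_integral_def)
    finally have e: "(LBINT x:{\<xi> - real m/2..\<xi> + real m/2}. (f x)\<^sup>2)
       = (\<integral>s. indicator {-(real m/2)..real m/2} s * (f (\<xi> + s))\<^sup>2 \<partial>lborel)" .
    have "integrable lborel (\<lambda>s. (f (\<xi> + s))\<^sup>2)"
      using lborel_integrable_real_affine[OF i, of 1 \<xi>] by simp
    then have ii: "integrable lborel (\<lambda>s. indicator {-(real m/2)..real m/2} s * (f (\<xi> + s))\<^sup>2)"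
      using integrable_mult_indicator[of "{-(real m/2)..real m/2}" lborel "\<lambda>s. (f (\<xi> + s))\<^sup>2"] by simp
    have "ennreal ((Aop m f \<xi>)\<^sup>2) \<le> ennreal (real m) *
        ennreal (\<integral>s. indicator {-(real m/2)..real m/2} s * (f (\<xi> + s))\<^sup>2 \<partial>lborel)"
      using Aop_power2_le_local[OF f m, of \<xi>]
      by (simp add: e ennreal_mult'[symmetric] ennreal_leI)
    also have "\<dots> = ennreal (real m) *
        (\<integral>\<^sup>+s. ennreal (indicator {-(real m/2)..real m/2} s * (f (\<xi> + s))\<^sup>2) \<partial>lborel)"
      using ii by (subst nn_integral_eq_integral) auto
    also have "\<dots> = (\<integral>\<^sup>+s. ennreal (real m) * (indicator {-(real m/2)..real m/2} s * ennreal ((f (\<xi> + s))\<^sup>2)) \<partial>lborel)"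
      by (subst nn_integral_cmult[symmetric]) (auto simp: ennreal_mult' intro!: nn_integral_cong split: split_indicator)
    finally show ?thesis .
  qed
  have "(\<integral>\<^sup>+\<xi>. ennreal ((Aop m f \<xi>)\<^sup>2) \<partial>lborel) \<le>
     (\<integral>\<^sup>+\<xi>. (\<integral>\<^sup>+s. ennreal (real m) * (indicator {-(real m/2)..real m/2} s * ennreal ((f (\<xi> + s))\<^sup>2)) \<partial>lborel) \<partial>lborel)"
    by (intro nn_integral_mono loc)
  also have "\<dots> = (\<integral>\<^sup>+s. (\<integral>\<^sup>+\<xi>. ennreal (real m) * (indicator {-(real m/2)..real m/2} s * ennreal ((f (\<xi> + s))\<^sup>2)) \<partial>lborel) \<partial>lborel)"
    by (rule lborel_pair.Fubini') measurable
  also have "\<dots> = (\<integral>\<^sup>+s. ennreal (real m) * (indicator {-(real m/2)..real m/2} s * ennreal ((L2norm f)\<^sup>2)) \<partial>lborel)"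
  proof (intro nn_integral_cong)
    fix s :: real
    have "(\<integral>\<^sup>+\<xi>. ennreal ((f (\<xi> + s))\<^sup>2) \<partial>lborel) = (\<integral>\<^sup>+\<xi>. ennreal ((f \<xi>)\<^sup>2) \<partial>lborel)"
      using nn_integral_real_affine[of "\<lambda>x. ennreal ((f x)\<^sup>2)" 1 s] by (simp add: add.commute)
    also have "\<dots> = ennreal ((L2norm f)\<^sup>2)"
      using i by (simp add: nn_integral_eq_integral L2norm_power2)
    finally show "(\<integral>\<^sup>+\<xi>. ennreal (real m) * (indicator {-(real m/2)..real m/2} s * ennreal ((f (\<xi> + s))\<^sup>2)) \<partial>lborel)
       = ennreal (real m) * (indicator {-(real m/2)..real m/2} s * ennreal ((L2norm f)\<^sup>2))"
      by (simp add: nn_integral_cmult)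
  qed
  also have "\<dots> = ennreal (real m) * (ennreal (real m) * ennreal ((L2norm f)\<^sup>2))"
    by (simp add: nn_integral_cmult nn_integral_multc)
  also have "\<dots> = ennreal ((real m)\<^sup>2 * (L2norm f)\<^sup>2)"
    by (simp add: ennreal_mult'[symmetric] power2_eq_square mult.assoc)
  finally have le: "(\<integral>\<^sup>+\<xi>. ennreal ((Aop m f \<xi>)\<^sup>2) \<partial>lborel) \<le> ennreal ((real m)\<^sup>2 * (L2norm f)\<^sup>2)" .
  have ia: "integrable lborel (\<lambda>\<xi>. (Aop m f \<xi>)\<^sup>2)"
    by (rule integrableI_bounded) (use Am le in \<open>auto simp: less_top[symmetric] top_unique intro: le_less_trans\<close>)
  with Am show "is_L2 (Aop m f)" by (simp add: is_L2_def)
  show "(L2norm (Aop m f))\<^sup>2 \<le> (real m)\<^sup>2 * (L2norm f)\<^sup>2"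
    using le ia by (simp add: nn_integral_eq_integral L2norm_power2)
qed

section \<open>The potentials\<close>

lemma Psi_has_derivative:
  assumes "r < \<nu> * real m"
  shows "(Psi \<nu> \<alpha> m has_field_derivative dPsi \<nu> \<alpha> m r) (at r)"
  unfolding Psi_def[abs_def] dPsi_def using assms
  by (auto intro!: derivative_eq_intros)

lemma dPsi_has_derivative:
  assumes "r < \<nu> * real m"
  shows "(dPsi \<nu> \<alpha> m has_field_derivative \<alpha> * (\<alpha> + 1) * (\<nu> * real m - r) powr (-\<alpha> - 2)) (at r)"
  unfolding dPsi_def[abs_def] using assms
  by (auto intro!: derivative_eq_intros) (simp add: algebra_simps minus_diff_commute)

lemma Psi_0: "Psi \<nu> \<alpha> m 0 = 0"
  by (simp add: Psi_def)

lemma dPsi_0: "dPsi \<nu> \<alpha> m 0 = 0"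
  by (simp add: dPsi_def)

lemma dPsi_mono:
  assumes "0 < \<alpha>" "r \<le> r'" "r' < \<nu> * real m"
  shows "dPsi \<nu> \<alpha> m r \<le> dPsi \<nu> \<alpha> m r'"
proof -
  have "(\<nu> * real m - r) powr (-\<alpha> - 1) \<le> (\<nu> * real m - r') powr (-\<alpha> - 1)"
    using assms by (intro powr_mono2') auto
  then show ?thesis using assms by (simp add: dPsi_def mult_left_mono)
qed

lemma dPsi_nonneg:
  assumes "0 < \<alpha>" "0 \<le> r" "r < \<nu> * real m"
  shows "0 \<le> dPsi \<nu> \<alpha> m r"
  using dPsi_mono[of \<alpha> 0 r] assms by (simp add: dPsi_0)

text \<open>\<open>dPsi\<close> vanishes at 0, so the mean value theorem bounds it by
  \<open>r\<close> times its derivative, which is largest nearest to the singularity;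
  \<open>k\<close> is the relative gap that remains. The power of \<open>m\<close> is split off for
  the later summation.\<close>

lemma dPsi_le:
  assumes "0 < \<nu>" "0 < \<alpha>" "0 < m" "0 < k" "0 \<le> r" "r \<le> (1 - k) * (\<nu> * real m)"
  shows "dPsi \<nu> \<alpha> m r \<le> \<alpha> * (\<alpha> + 1) * (k * \<nu>) powr (-\<alpha> - 2) * real m powr (-\<alpha> - 2) * r"
proof -
  have pos: "0 < k * (\<nu> * real m)" using assms by simp
  have lt: "z < \<nu> * real m" if "z \<le> r" for z
    using that assms(6) pos by (simp add: algebra_simps)
  show ?thesis
  proof (cases "r = 0")
    case False
    then have "0 < r" using assms by simp
    obtain z where z: "0 < z" "z < r"
      and e: "dPsi \<nu> \<alpha> m r - dPsi \<nu> \<alpha> m 0 = (r - 0) * (\<alpha> * (\<alpha> + 1) * (\<nu> * real m - z) powr (-\<alpha> - 2))"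
      using MVT2[OF \<open>0 < r\<close>, where f = "dPsi \<nu> \<alpha> m", OF dPsi_has_derivative[OF lt]] by auto
    have "(\<nu> * real m - z) powr (-\<alpha> - 2) \<le> (k * (\<nu> * real m)) powr (-\<alpha> - 2)"
      using assms z pos by (intro powr_mono2') (auto simp: algebra_simps)
    also have "\<dots> = (k * \<nu>) powr (-\<alpha> - 2) * real m powr (-\<alpha> - 2)"
      using assms by (simp add: powr_mult mult.assoc)
    finally have "(\<nu> * real m - z) powr (-\<alpha> - 2) \<le> (k * \<nu>) powr (-\<alpha> - 2) * real m powr (-\<alpha> - 2)" .
    then have "r * (\<alpha> * (\<alpha> + 1) * (\<nu> * real m - z) powr (-\<alpha> - 2))
       \<le> r * (\<alpha> * (\<alpha> + 1) * ((k * \<nu>) powr (-\<alpha> - 2) * real m powr (-\<alpha> - 2)))"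
      using assms by (intro mult_left_mono) auto
    then show ?thesis using e by (simp add: dPsi_0 mult_ac)
  qed (simp add: dPsi_0)
qed

text \<open>The mean value theorem once more: the intermediate slope lies between 0 and
  \<open>dPsi\<close> at \<open>r\<close>, to which \<open>dPsi_le\<close> applies.\<close>

lemma Psi_bounds:
  assumes "0 < \<nu>" "0 < \<alpha>" "0 < m" "0 < k" "0 \<le> r" "r \<le> (1 - k) * (\<nu> * real m)"
  shows "0 \<le> Psi \<nu> \<alpha> m r"
    and "Psi \<nu> \<alpha> m r \<le> \<alpha> * (\<alpha> + 1) * (k * \<nu>) powr (-\<alpha> - 2) * real m powr (-\<alpha> - 2) * r\<^sup>2"
proof -
  let ?C = "\<alpha> * (\<alpha> + 1) * (k * \<nu>) powr (-\<alpha> - 2) * real m powr (-\<alpha> - 2)"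
  have pos: "0 < k * (\<nu> * real m)" using assms by simp
  have lt: "z < \<nu> * real m" if "z \<le> r" for z
    using that assms(6) pos by (simp add: algebra_simps)
  have "0 \<le> Psi \<nu> \<alpha> m r \<and> Psi \<nu> \<alpha> m r \<le> ?C * r\<^sup>2"
  proof (cases "r = 0")
    case False
    then have "0 < r" using assms by simp
    obtain z where z: "0 < z" "z < r"
      and e: "Psi \<nu> \<alpha> m r - Psi \<nu> \<alpha> m 0 = (r - 0) * dPsi \<nu> \<alpha> m z"
      using MVT2[OF \<open>0 < r\<close>, where f = "Psi \<nu> \<alpha> m", OF Psi_has_derivative[OF lt]] by auto
    have "0 \<le> dPsi \<nu> \<alpha> m z" using assms z lt by (intro dPsi_nonneg) auto
    moreover have "dPsi \<nu> \<alpha> m z \<le> dPsi \<nu> \<alpha> m r" using assms z lt by (intro dPsi_mono) auto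
    moreover have "dPsi \<nu> \<alpha> m r \<le> ?C * r" using assms by (rule dPsi_le)
    ultimately have "0 \<le> r * dPsi \<nu> \<alpha> m z" "r * dPsi \<nu> \<alpha> m z \<le> r * (?C * r)"
      using \<open>0 < r\<close> by (auto intro!: mult_left_mono)
    moreover have "r * (?C * r) = ?C * r\<^sup>2" by (simp only: power2_eq_square mult_ac)
    moreover have "Psi \<nu> \<alpha> m r = r * dPsi \<nu> \<alpha> m z" using e by (simp add: Psi_0)
    ultimately show ?thesis by simp
  qed (simp add: Psi_0)
  then show "0 \<le> Psi \<nu> \<alpha> m r" "Psi \<nu> \<alpha> m r \<le> ?C * r\<^sup>2" by auto
qed

section \<open>Energy and gradient away from the singularity\<close>

text \<open>Every average keeps the relative distance \<open>k\<close> from its singularity,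
  uniformly in \<open>m\<close>. The locale serves in two ways: with a gap that closes as
  \<open>\<delta>\<close> tends to 0, for all profiles of the given kinetic energy, and with a fixed
  gap, in the contradiction that forces the central average up to \<open>\<nu>\<close>.\<close>

locale gap_profile =
  fixes \<nu> \<alpha> k :: real and W :: "real \<Rightarrow> real"
  assumes nu: "0 < \<nu>" and alpha: "1 < \<alpha>" and k: "0 < k"
    and L2: "is_L2 W"
    and Aop_ge: "\<And>m s. 0 < m \<Longrightarrow> 0 \<le> Aop m W s"
    and Aop_le: "\<And>m s. 0 < m \<Longrightarrow> Aop m W s \<le> (1 - k) * (\<nu> * real m)"
begin

definition C :: real where "C = \<alpha> * (\<alpha> + 1) * (k * \<nu>) powr (-\<alpha> - 2)"

lemma C_nonneg: "0 \<le> C"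
  using alpha by (simp add: C_def)

lemma Psi_measurable [measurable]: "Psi \<nu> \<alpha> m \<in> borel_measurable borel"
  unfolding Psi_def[abs_def] by measurable

lemma dPsi_measurable [measurable]: "dPsi \<nu> \<alpha> m \<in> borel_measurable borel"
  unfolding dPsi_def[abs_def] by measurable

lemma AW_measurable [measurable]: "Aop m W \<in> borel_measurable borel"
  using L2 by (intro Aop_measurable) (simp add: is_L2_def)

text \<open>Averaging costs a factor \<open>m^2\<close> in squared norm (\<open>Aop_is_L2\<close>);
  against the decay of the second derivative of \<open>Psi\<close> this leaves weights that are
  summable for \<open>\<alpha> > 1\<close>.\<close>

lemma powr_shift: "real (Suc m) powr (-\<alpha> - 2) * (real (Suc m))\<^sup>2 = real (Suc m) powr (-\<alpha>)"
proof -
  have "(real (Suc m))\<^sup>2 = real (Suc m) powr 2" by simp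
  then show ?thesis by (simp only: powr_add[symmetric]) simp
qed

lemma Psi_Aop_nonneg: "0 \<le> Psi \<nu> \<alpha> (Suc m) (Aop (Suc m) W s)"
  using nu alpha k by (intro Psi_bounds(1)[of \<nu> \<alpha> _ k] Aop_ge Aop_le) auto

lemma Psi_Aop_le: "Psi \<nu> \<alpha> (Suc m) (Aop (Suc m) W s)
    \<le> C * real (Suc m) powr (-\<alpha> - 2) * (Aop (Suc m) W s)\<^sup>2"
  unfolding C_def using nu alpha k by (intro Psi_bounds(2) Aop_ge Aop_le) auto

lemma dPsi_Aop_nonneg: "0 \<le> dPsi \<nu> \<alpha> (Suc m) (Aop (Suc m) W s)"
proof -
  have "(1 - k) * (\<nu> * real (Suc m)) < \<nu> * real (Suc m)" using nu k by simp
  then have "Aop (Suc m) W s < \<nu> * real (Suc m)"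
    by (rule le_less_trans[OF Aop_le, rotated]) simp
  then show ?thesis using alpha by (intro dPsi_nonneg Aop_ge) auto
qed

lemma dPsi_Aop_le: "dPsi \<nu> \<alpha> (Suc m) (Aop (Suc m) W s)
    \<le> C * real (Suc m) powr (-\<alpha> - 2) * Aop (Suc m) W s"
  unfolding C_def using nu alpha k by (intro dPsi_le Aop_ge Aop_le) auto

lemma summable_weights: "summable (\<lambda>m. real (Suc m) powr (-\<alpha>))"
  using alpha by (subst summable_Suc_iff) (simp add: summable_real_powr_iff)

text \<open>The factor \<open>m\<close> from Cauchy-Schwarz is enlarged to \<open>m^2\<close>, so
  that the same weights dominate the pointwise series and the series of integrals.\<close>

lemma Psi_Aop_le_const: "Psi \<nu> \<alpha> (Suc m) (Aop (Suc m) W s)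
    \<le> C * (L2norm W)\<^sup>2 * real (Suc m) powr (-\<alpha>)"
proof -
  have "Psi \<nu> \<alpha> (Suc m) (Aop (Suc m) W s)
      \<le> C * real (Suc m) powr (-\<alpha> - 2) * (Aop (Suc m) W s)\<^sup>2"
    by (rule Psi_Aop_le)
  also have "\<dots> \<le> C * real (Suc m) powr (-\<alpha> - 2) * ((real (Suc m))\<^sup>2 * (L2norm W)\<^sup>2)"
  proof (intro mult_left_mono)
    have "(Aop (Suc m) W s)\<^sup>2 \<le> real (Suc m) * (L2norm W)\<^sup>2"
      by (rule Aop_power2_le[OF L2]) simp
    also have "\<dots> \<le> (real (Suc m))\<^sup>2 * (L2norm W)\<^sup>2"
      by (intro mult_right_mono) (auto simp: power2_eq_square)
    finally show "(Aop (Suc m) W s)\<^sup>2 \<le> (real (Suc m))\<^sup>2 * (L2norm W)\<^sup>2" .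
  qed (use C_nonneg in auto)
  also have "\<dots> = C * (L2norm W)\<^sup>2 * (real (Suc m) powr (-\<alpha> - 2) * (real (Suc m))\<^sup>2)"
    by (simp only: mult_ac)
  finally show ?thesis unfolding powr_shift .
qed

lemma summable_Psi_Aop: "summable (\<lambda>m. Psi \<nu> \<alpha> (Suc m) (Aop (Suc m) W s))"
  by (rule summable_comparison_test'[OF summable_mult[OF summable_weights, of "C * (L2norm W)\<^sup>2"], where N = 0])
     (simp only: real_norm_def abs_of_nonneg[OF Psi_Aop_nonneg] Psi_Aop_le_const)

lemma integrable_Psi_Aop: "integrable lborel (\<lambda>s. Psi \<nu> \<alpha> (Suc m) (Aop (Suc m) W s))"
  and integral_Psi_Aop_le: "(\<integral>s. Psi \<nu> \<alpha> (Suc m) (Aop (Suc m) W s) \<partial>lborel)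
     \<le> C * (L2norm W)\<^sup>2 * real (Suc m) powr (-\<alpha>)"
proof -
  have A: "is_L2 (Aop (Suc m) W)" "(L2norm (Aop (Suc m) W))\<^sup>2 \<le> (real (Suc m))\<^sup>2 * (L2norm W)\<^sup>2"
    by (rule Aop_is_L2[OF L2]; simp)+
  have i: "integrable lborel (\<lambda>s. C * real (Suc m) powr (-\<alpha> - 2) * (Aop (Suc m) W s)\<^sup>2)"
    using A(1) by (auto simp: is_L2_def)
  show j: "integrable lborel (\<lambda>s. Psi \<nu> \<alpha> (Suc m) (Aop (Suc m) W s))"
  proof (rule Bochner_Integration.integrable_bound[OF i])
    show "AE s in lborel. norm (Psi \<nu> \<alpha> (Suc m) (Aop (Suc m) W s))
       \<le> norm (C * real (Suc m) powr (-\<alpha> - 2) * (Aop (Suc m) W s)\<^sup>2)"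
      using Psi_Aop_nonneg Psi_Aop_le C_nonneg by (intro AE_I2) (auto intro: order_trans)
  qed measurable
  have "(\<integral>s. Psi \<nu> \<alpha> (Suc m) (Aop (Suc m) W s) \<partial>lborel)
     \<le> (\<integral>s. C * real (Suc m) powr (-\<alpha> - 2) * (Aop (Suc m) W s)\<^sup>2 \<partial>lborel)"
    by (rule integral_mono[OF j i]) (rule Psi_Aop_le)
  also have "\<dots> = C * real (Suc m) powr (-\<alpha> - 2) * (L2norm (Aop (Suc m) W))\<^sup>2"
    by (simp add: L2norm_power2)
  also have "\<dots> \<le> C * real (Suc m) powr (-\<alpha> - 2) * ((real (Suc m))\<^sup>2 * (L2norm W)\<^sup>2)"
    by (intro mult_left_mono A) (use C_nonneg in auto)
  also have "\<dots> = C * (L2norm W)\<^sup>2 * (real (Suc m) powr (-\<alpha> - 2) * (real (Suc m))\<^sup>2)"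
    by (simp only: mult_ac)
  finally show "(\<integral>s. Psi \<nu> \<alpha> (Suc m) (Aop (Suc m) W s) \<partial>lborel)
     \<le> C * (L2norm W)\<^sup>2 * real (Suc m) powr (-\<alpha>)" unfolding powr_shift .
qed

text \<open>Sum and integral may be exchanged because the terms are nonnegative and their integrals
  summable.\<close>

lemma Pot_sums: "(\<lambda>m. \<integral>s. Psi \<nu> \<alpha> (Suc m) (Aop (Suc m) W s) \<partial>lborel) sums Pot \<nu> \<alpha> W"
proof -
  have s: "summable (\<lambda>m. \<integral>s. Psi \<nu> \<alpha> (Suc m) (Aop (Suc m) W s) \<partial>lborel)"
    by (rule summable_comparison_test'[OF summable_mult[OF summable_weights, of "C * (L2norm W)\<^sup>2"], where N = 0])
       (simp only: real_norm_def abs_of_nonneg[OF Bochner_Integration.integral_nonneg] Psi_Aop_nonneg integral_Psi_Aop_le)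
  have "summable (\<lambda>m. \<integral>s. norm (Psi \<nu> \<alpha> (Suc m) (Aop (Suc m) W s)) \<partial>lborel)"
    using s Psi_Aop_nonneg by simp
  then have "Pot \<nu> \<alpha> W = (\<Sum>m. \<integral>s. Psi \<nu> \<alpha> (Suc m) (Aop (Suc m) W s) \<partial>lborel)"
    unfolding Pot_def using summable_Psi_Aop Psi_Aop_nonneg
    by (intro integral_suminf integrable_Psi_Aop) auto
  with s show ?thesis by (simp add: summable_sums)
qed

text \<open>For a fixed gap the constant is uniform over profiles of bounded norm: the energy can
  become large only if the gap closes.\<close>

lemma Pot_le: "Pot \<nu> \<alpha> W \<le> C * (L2norm W)\<^sup>2 * (\<Sum>m. real (Suc m) powr (-\<alpha>))"
  using Pot_sums summable_sums[OF summable_mult[OF summable_weights, of "C * (L2norm W)\<^sup>2"]]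
  unfolding suminf_mult[OF summable_weights]
  by (rule sums_le[rotated 1]) (rule integral_Psi_Aop_le)

lemma Pot_ge_first: "(\<integral>s. Psi \<nu> \<alpha> 1 (Aop 1 W s) \<partial>lborel) \<le> Pot \<nu> \<alpha> W"
proof -
  have "(\<Sum>m\<in>{0}. \<integral>s. Psi \<nu> \<alpha> (Suc m) (Aop (Suc m) W s) \<partial>lborel) \<le> Pot \<nu> \<alpha> W"
    using sums_unique[OF Pot_sums] sums_summable[OF Pot_sums] Psi_Aop_nonneg
    by (simp only:) (intro sum_le_suminf, auto simp: integral_nonneg_AE)
  then show ?thesis by simp
qed

section \<open>Square-integrability of the gradient\<close>

definition dPot_term :: "nat \<Rightarrow> real \<Rightarrow> real" where
  "dPot_term m = Aop (Suc m) (\<lambda>s. dPsi \<nu> \<alpha> (Suc m) (Aop (Suc m) W s))"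

lemma dPot_term_nonneg: "0 \<le> dPot_term m \<xi>"
  unfolding dPot_term_def by (intro Aop_nonneg dPsi_Aop_nonneg)

text \<open>The inner average costs one factor \<open>m^2\<close>; the other one, on the left of the
  estimate, anticipates the outer average in \<open>dPot_term\<close>.\<close>

lemma dPsi_Aop_L2: "is_L2 (\<lambda>s. dPsi \<nu> \<alpha> (Suc m) (Aop (Suc m) W s))"
  and L2norm_dPsi_Aop: "(real (Suc m))\<^sup>2 * (L2norm (\<lambda>s. dPsi \<nu> \<alpha> (Suc m) (Aop (Suc m) W s)))\<^sup>2
     \<le> (C * L2norm W * real (Suc m) powr (-\<alpha>))\<^sup>2"
proof -
  let ?g = "\<lambda>s. dPsi \<nu> \<alpha> (Suc m) (Aop (Suc m) W s)"
  let ?c = "C * real (Suc m) powr (-\<alpha> - 2)"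
  have A: "is_L2 (Aop (Suc m) W)" "(L2norm (Aop (Suc m) W))\<^sup>2 \<le> (real (Suc m))\<^sup>2 * (L2norm W)\<^sup>2"
    by (rule Aop_is_L2[OF L2]; simp)+
  have i: "integrable lborel (\<lambda>s. ?c\<^sup>2 * (Aop (Suc m) W s)\<^sup>2)"
    using A(1) by (auto simp: is_L2_def)
  have le: "(?g s)\<^sup>2 \<le> ?c\<^sup>2 * (Aop (Suc m) W s)\<^sup>2" for s
    using power_mono[OF dPsi_Aop_le dPsi_Aop_nonneg, of m s 2] by (simp add: power_mult_distrib)
  have j: "integrable lborel (\<lambda>s. (?g s)\<^sup>2)"
    by (rule Bochner_Integration.integrable_bound[OF i])
       (measurable, use le in \<open>auto intro!: AE_I2\<close>)
  show "is_L2 ?g" unfolding is_L2_def using j by auto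
  have "(L2norm ?g)\<^sup>2 \<le> ?c\<^sup>2 * (L2norm (Aop (Suc m) W))\<^sup>2"
    unfolding L2norm_power2 using integral_mono[OF j i le] by simp
  also have "\<dots> \<le> ?c\<^sup>2 * ((real (Suc m))\<^sup>2 * (L2norm W)\<^sup>2)"
    by (intro mult_left_mono A) auto
  finally have gn: "(L2norm ?g)\<^sup>2 \<le> ?c\<^sup>2 * ((real (Suc m))\<^sup>2 * (L2norm W)\<^sup>2)" .
  have "(real (Suc m))\<^sup>2 * (L2norm ?g)\<^sup>2 \<le> (real (Suc m))\<^sup>2 * (?c\<^sup>2 * ((real (Suc m))\<^sup>2 * (L2norm W)\<^sup>2))"
    by (intro mult_left_mono gn) auto
  also have "(real (Suc m))\<^sup>2 * (?c\<^sup>2 * ((real (Suc m))\<^sup>2 * (L2norm W)\<^sup>2))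
      = (C * L2norm W * real (Suc m) powr (-\<alpha>))\<^sup>2"
    by (subst powr_shift[symmetric]) (simp only: power_mult_distrib power2_eq_square mult_ac)
  finally show "(real (Suc m))\<^sup>2 * (L2norm ?g)\<^sup>2 \<le> (C * L2norm W * real (Suc m) powr (-\<alpha>))\<^sup>2" .
qed

lemma dPot_term_L2: "is_L2 (dPot_term m)"
  unfolding dPot_term_def by (rule Aop_is_L2(1)[OF dPsi_Aop_L2]) simp

lemma L2norm_dPot_term: "(L2norm (dPot_term m))\<^sup>2 \<le> (C * L2norm W * real (Suc m) powr (-\<alpha>))\<^sup>2"
  unfolding dPot_term_def by (rule order_trans[OF Aop_is_L2(2)[OF dPsi_Aop_L2] L2norm_dPsi_Aop]) simp

lemma dPot_term_le: "dPot_term m \<xi> \<le> C * L2norm W * real (Suc m) powr (-\<alpha>)"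
proof -
  let ?g = "\<lambda>s. dPsi \<nu> \<alpha> (Suc m) (Aop (Suc m) W s)"
  have "(dPot_term m \<xi>)\<^sup>2 \<le> real (Suc m) * (L2norm ?g)\<^sup>2"
    unfolding dPot_term_def by (rule Aop_power2_le[OF dPsi_Aop_L2]) simp
  also have "\<dots> \<le> (real (Suc m))\<^sup>2 * (L2norm ?g)\<^sup>2"
    by (intro mult_right_mono) (auto simp: power2_eq_square)
  also have "\<dots> \<le> (C * L2norm W * real (Suc m) powr (-\<alpha>))\<^sup>2"
    by (rule L2norm_dPsi_Aop)
  finally show ?thesis by (rule power2_le_imp_le) (use C_nonneg in auto)
qed

lemma dPot_term_measurable [measurable]: "dPot_term m \<in> borel_measurable borel"
  using dPot_term_L2[of m] by (simp add: is_L2_def)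

lemma summable_dPot_term: "summable (\<lambda>m. dPot_term m \<xi>)"
  by (rule summable_comparison_test'[OF summable_mult[OF summable_weights, of "C * L2norm W"], where N = 0])
     (simp only: real_norm_def abs_of_nonneg[OF dPot_term_nonneg] dPot_term_le)

lemma dPot_eq: "dPot \<nu> \<alpha> W \<xi> = (\<Sum>m. dPot_term m \<xi>)"
  by (simp add: dPot_def dPot_term_def)

lemma dPot_ge_first: "dPot_term 0 \<xi> \<le> dPot \<nu> \<alpha> W \<xi>"
  using sum_le_suminf[OF summable_dPot_term, of "{0}" \<xi>] by (simp add: dPot_eq dPot_term_nonneg)

end

text \<open>Cauchy-Schwarz for a summable weight: the variance around the weighted mean
  \<open>c\<close> is nonnegative. It does the work of Minkowski's inequality for the infinite sum
  in \<open>dPot\<close>.\<close>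

lemma weighted_suminf_power2_le:
  fixes a x :: "nat \<Rightarrow> real"
  assumes a: "\<And>n. 0 < a n" and "summable a" "summable (\<lambda>n. a n * x n)" "summable (\<lambda>n. a n * (x n)\<^sup>2)"
  shows "(\<Sum>n. a n * x n)\<^sup>2 \<le> (\<Sum>n. a n) * (\<Sum>n. a n * (x n)\<^sup>2)"
proof -
  define T where "T = (\<Sum>n. a n)"
  define c where "c = (\<Sum>n. a n * x n) / T"
  have T: "0 < T" unfolding T_def using assms by (intro suminf_pos)
  have s: "summable (\<lambda>n. a n * (x n)\<^sup>2 - 2 * c * (a n * x n) + c\<^sup>2 * a n)"
    by (intro summable_add summable_diff summable_mult assms)
  have "0 \<le> (\<Sum>n. a n * (x n)\<^sup>2 - 2 * c * (a n * x n) + c\<^sup>2 * a n)"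
  proof (rule suminf_nonneg[OF s])
    fix n
    have "a n * (x n)\<^sup>2 - 2 * c * (a n * x n) + c\<^sup>2 * a n = a n * (x n - c)\<^sup>2"
      by (simp add: power2_eq_square algebra_simps)
    then show "0 \<le> a n * (x n)\<^sup>2 - 2 * c * (a n * x n) + c\<^sup>2 * a n" using a[of n] by simp
  qed
  also have "\<dots> = (\<Sum>n. a n * (x n)\<^sup>2) - 2 * c * (\<Sum>n. a n * x n) + c\<^sup>2 * T"
    unfolding T_def using assms
    by (simp add: suminf_add[symmetric] suminf_diff[symmetric] suminf_mult summable_mult summable_diff)
  also have "(\<Sum>n. a n * x n) = c * T" using T by (simp add: c_def)
  finally have "c\<^sup>2 * T \<le> (\<Sum>n. a n * (x n)\<^sup>2)" by (simp add: power2_eq_square algebra_simps)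
  then have "T * (c\<^sup>2 * T) \<le> T * (\<Sum>n. a n * (x n)\<^sup>2)" using T by (intro mult_left_mono) auto
  then show ?thesis unfolding T_def[symmetric] \<open>(\<Sum>n. a n * x n) = c * T\<close>
    by (simp add: power2_eq_square mult_ac)
qed

context gap_profile
begin

text \<open>After division by the weights \<open>a m\<close> the terms have squared norms bounded
  uniformly in \<open>m\<close>. The weighted sum of their squares is therefore integrable, and
  times the total weight it dominates the square of \<open>dPot\<close>. The lower bound on
  \<open>L2norm\<close> of the gradient relies on this integrability, since the integral of a
  non-integrable function is 0 by convention.\<close>

lemma dPot_L2: "is_L2 (dPot \<nu> \<alpha> W)"
proof -
  define a where "a m = real (Suc m) powr (-\<alpha>)" for m
  define x where "x m \<xi> = dPot_term m \<xi> / a m" for m \<xi>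
  have a: "0 < a m" for m by (simp add: a_def)
  have sa: "summable a" using summable_weights by (simp add: a_def[abs_def])
  have xm [measurable]: "x m \<in> borel_measurable borel" for m
    unfolding x_def[abs_def] by measurable
  have ax: "a m * x m \<xi> = dPot_term m \<xi>" for m \<xi> using a[of m] by (simp add: x_def)
  let ?B = "(C * L2norm W)\<^sup>2"
  have x_le: "(x m \<xi>)\<^sup>2 \<le> ?B" for m \<xi>
    using dPot_term_le[of m \<xi>] dPot_term_nonneg[of m \<xi>] a[of m]
    by (intro power_mono) (auto simp: x_def a_def pos_divide_le_eq)
  have xi: "integrable lborel (\<lambda>\<xi>. (x m \<xi>)\<^sup>2)" for m
    using dPot_term_L2[of m] by (simp add: x_def power_divide is_L2_def)
  have xint: "(\<integral>\<xi>. (x m \<xi>)\<^sup>2 \<partial>lborel) \<le> ?B" for m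
  proof -
    have "(\<integral>\<xi>. (x m \<xi>)\<^sup>2 \<partial>lborel) = (L2norm (dPot_term m))\<^sup>2 / (a m)\<^sup>2"
      by (simp add: x_def power_divide L2norm_power2)
    also have "\<dots> \<le> ?B"
      using L2norm_dPot_term[of m] a[of m] by (simp add: pos_divide_le_eq a_def power_mult_distrib)
    finally show ?thesis .
  qed
  have sx2: "summable (\<lambda>m. a m * (x m \<xi>)\<^sup>2)" for \<xi>
    by (rule summable_comparison_test'[OF summable_mult2[OF sa, of ?B], where N = 0])
       (use a x_le in \<open>auto simp: less_imp_le intro!: mult_left_mono\<close>)
  have "integrable lborel (\<lambda>\<xi>. \<Sum>m. a m * (x m \<xi>)\<^sup>2)"
  proof (rule integrable_suminf)
    show "summable (\<lambda>m. \<integral>\<xi>. norm (a m * (x m \<xi>)\<^sup>2) \<partial>lborel)"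
      by (rule summable_comparison_test'[OF summable_mult2[OF sa, of ?B], where N = 0])
         (use a xint in \<open>auto simp: less_imp_le abs_mult intro!: mult_left_mono\<close>)
  qed (use a sx2 xi in \<open>auto simp: abs_mult less_imp_le\<close>)
  then have i: "integrable lborel (\<lambda>\<xi>. (\<Sum>m. a m) * (\<Sum>m. a m * (x m \<xi>)\<^sup>2))" by simp
  have m: "dPot \<nu> \<alpha> W \<in> borel_measurable lborel"
    unfolding dPot_eq[abs_def] by measurable
  have "(dPot \<nu> \<alpha> W \<xi>)\<^sup>2 \<le> (\<Sum>m. a m) * (\<Sum>m. a m * (x m \<xi>)\<^sup>2)" for \<xi>
    using weighted_suminf_power2_le[of a "\<lambda>m. x m \<xi>"] a sa sx2[of \<xi>] summable_dPot_term[of \<xi>]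
    by (simp add: ax dPot_eq)
  then have "integrable lborel (\<lambda>\<xi>. (dPot \<nu> \<alpha> W \<xi>)\<^sup>2)"
    by (intro Bochner_Integration.integrable_bound[OF i] AE_I2)
       (use m in \<open>auto intro: order_trans[OF _ abs_ge_self]\<close>)
  with m show ?thesis by (simp add: is_L2_def)
qed

end

section \<open>The cone of even unimodal profiles\<close>

lemma C0_differentiable:
  assumes "\<phi> \<in> C0"
  shows "\<phi> differentiable (at x)"
proof -
  have "\<forall>k x. (deriv ^^ k) \<phi> differentiable (at x)"
    using assms by (simp add: C0_def smooth_def)
  from spec[OF spec[OF this, of 0], of x] show ?thesis by simp
qed

lemma C0_continuous: "\<phi> \<in> C0 \<Longrightarrow> continuous_on A \<phi>"
  by (intro continuous_at_imp_continuous_on ballI differentiable_imp_continuous_within C0_differentiable)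

lemma C0_is_L2:
  assumes "\<phi> \<in> C0"
  shows "is_L2 \<phi>"
proof -
  let ?S = "closure {x. \<phi> x \<noteq> 0}"
  have m: "\<phi> \<in> borel_measurable borel"
    by (intro borel_measurable_continuous_onI C0_continuous assms)
  have "compact ?S" using assms by (simp add: C0_def compact_support_def)
  then have "integrable lborel (\<lambda>x. indicator ?S x *\<^sub>R (\<phi> x)\<^sup>2)"
    by (intro borel_integrable_compact continuous_intros C0_continuous assms)
  also have "(\<lambda>x. indicator ?S x *\<^sub>R (\<phi> x)\<^sup>2) = (\<lambda>x. (\<phi> x)\<^sup>2)"
    using closure_subset[of "{x. \<phi> x \<noteq> 0}"] by (fastforce simp: indicator_def)
  finally show ?thesis using m by (simp add: is_L2_def)
qed

section \<open>Shape of the smooth profiles\<close>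

lemma C0_profile:
  assumes "\<phi> \<in> C0" "0 \<le> x"
  shows "\<phi> x = \<phi> (-x)" "0 \<le> \<phi> x" "deriv \<phi> x \<le> 0"
proof -
  have "\<forall>x\<ge>0. \<phi> x = \<phi> (-x) \<and> 0 \<le> \<phi> x \<and> deriv \<phi> x = - deriv \<phi> (-x) \<and> deriv \<phi> x \<le> 0"
    using assms(1) unfolding C0_def by (elim CollectE conjE)
  then show "\<phi> x = \<phi> (-x)" "0 \<le> \<phi> x" "deriv \<phi> x \<le> 0" using assms(2) by fast+
qed

lemma C0_even: "\<phi> \<in> C0 \<Longrightarrow> \<phi> \<bar>x\<bar> = \<phi> x"
  using C0_profile(1)[of \<phi> "\<bar>x\<bar>"] by (cases "0 \<le> x") simp_all

lemma C0_nonneg: "\<phi> \<in> C0 \<Longrightarrow> 0 \<le> \<phi> x"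
  using C0_profile(2)[of \<phi> "\<bar>x\<bar>"] C0_even[of \<phi> x] by simp

text \<open>The sign of the derivative on the half line compares the values at
  \<open>\<bar>x\<bar>\<close> and \<open>\<bar>y\<bar>\<close>; evenness removes the absolute
  values.\<close>

lemma C0_antimono:
  assumes "\<phi> \<in> C0" and "\<bar>x\<bar> \<le> \<bar>y\<bar>"
  shows "\<phi> y \<le> \<phi> x"
proof -
  have "\<exists>d. (\<phi> has_real_derivative d) (at z) \<and> d \<le> 0" if "\<bar>x\<bar> \<le> z" for z
  proof (intro exI conjI)
    show "(\<phi> has_real_derivative deriv \<phi> z) (at z)"
      using C0_differentiable[OF assms(1)] by (simp add: DERIV_deriv_iff_real_differentiable)
    show "deriv \<phi> z \<le> 0" by (rule C0_profile(3)[OF assms(1)]) (use that in linarith)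
  qed
  then have "\<phi> \<bar>y\<bar> \<le> \<phi> \<bar>x\<bar>"
    by (rule DERIV_nonpos_imp_nonincreasing[OF assms(2)])
  then show ?thesis by (simp add: C0_even[OF assms(1)])
qed

text \<open>Bathtub argument: subtracting the value \<open>\<phi> (1/2)\<close> does not change the difference of
  the two integrals and makes the integrand of the difference nonnegative.\<close>

lemma C0_Aop_le_center:
  assumes phi: "\<phi> \<in> C0"
  shows "Aop 1 \<phi> s \<le> Aop 1 \<phi> 0"
proof -
  define c where "c = \<phi> (1/2)"
  let ?I = "\<lambda>s. {s - 1/2..s + 1/2 :: real}"
  have L2: "is_L2 \<phi>" by (rule C0_is_L2[OF phi])
  have i: "integrable lborel (\<lambda>x. indicator (?I s) x * (\<phi> x - c))" for s
  proof -
    have "set_integrable lborel (?I s) (\<lambda>x. \<phi> x - c)"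
      by (intro set_integral_diff is_L2_set_integrable[OF L2]) (simp add: set_integrable_def)
    then show ?thesis by (simp add: set_integrable_def)
  qed
  have A: "Aop 1 \<phi> s - c = (\<integral>x. indicator (?I s) x * (\<phi> x - c) \<partial>lborel)" for s
  proof -
    have "(LBINT x:?I s. \<phi> x - c) = (LBINT x:?I s. \<phi> x) - (LBINT x:?I s. c)"
      by (intro set_integral_diff is_L2_set_integrable[OF L2]) (simp add: set_integrable_def)
    then show ?thesis by (simp add: Aop_eq set_lebesgue_integral_def)
  qed
  have "(\<integral>x. indicator (?I s) x * (\<phi> x - c) \<partial>lborel) \<le> (\<integral>x. indicator (?I 0) x * (\<phi> x - c) \<partial>lborel)"
  proof (rule integral_mono[OF i i])
    fix x
    show "indicator (?I s) x * (\<phi> x - c) \<le> indicator (?I 0) x * (\<phi> x - c)"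
    proof (cases "x \<in> ?I 0")
      case True
      then have "c \<le> \<phi> x" unfolding c_def by (intro C0_antimono[OF phi]) (auto simp: abs_le_iff)
      with True show ?thesis by (cases "x \<in> ?I s") simp_all
    next
      case False
      then have "1/2 \<le> \<bar>x\<bar>" by (auto simp: abs_real_def)
      then have "\<phi> x \<le> c" unfolding c_def by (intro C0_antimono[OF phi]) simp
      with False show ?thesis by (cases "x \<in> ?I s") simp_all
    qed
  qed
  with A[of s] A[of 0] show ?thesis by simp
qed

section \<open>Passage from smooth profiles to the closed cone\<close>

lemma Ccone_is_L2: "W \<in> Ccone \<Longrightarrow> is_L2 W"
  by (simp add: Ccone_def)

text \<open>For fixed \<open>m\<close> and \<open>s\<close> the average is a continuous functional
  on square-integrable functions, by \<open>Aop_abs_le\<close>. Inequalities between averages hence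
  pass to the closure, where \<open>W\<close> itself is determined only up to null sets.\<close>

lemma Ccone_Aop_limit:
  assumes "W \<in> Ccone"
  shows "\<exists>\<phi>. (\<forall>n. \<phi> n \<in> C0) \<and> (\<forall>m>0. \<forall>s. (\<lambda>n. Aop m (\<phi> n) s) \<longlonglongrightarrow> Aop m W s)"
proof -
  obtain \<phi> where phi: "\<And>n. \<phi> n \<in> C0" and lim: "(\<lambda>n. L2norm (\<lambda>x. \<phi> n x - W x)) \<longlonglongrightarrow> 0"
    using assms by (auto simp: Ccone_def)
  have "(\<lambda>n. Aop m (\<phi> n) s) \<longlonglongrightarrow> Aop m W s" if "0 < m" for m s
  proof (rule LIM_zero_cancel, rule Lim_null_comparison)
    show "\<forall>\<^sub>F n in sequentially. norm (Aop m (\<phi> n) s - Aop m W s) \<le> sqrt (real m) * L2norm (\<lambda>x. \<phi> n x - W x)"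
      using Aop_abs_le[OF is_L2_diff[OF C0_is_L2[OF phi] Ccone_is_L2[OF assms]] that]
      by (simp add: Aop_diff[OF C0_is_L2[OF phi] Ccone_is_L2[OF assms]])
    show "(\<lambda>n. sqrt (real m) * L2norm (\<lambda>x. \<phi> n x - W x)) \<longlonglongrightarrow> 0"
      using tendsto_mult_left[OF lim, of "sqrt (real m)"] by simp
  qed
  with phi show ?thesis by auto
qed

lemma Ccone_Aop_nonneg:
  assumes "W \<in> Ccone" "0 < m"
  shows "0 \<le> Aop m W s"
proof -
  obtain \<phi> where phi: "\<And>n. \<phi> n \<in> C0" and lim: "\<And>m s. 0 < m \<Longrightarrow> (\<lambda>n. Aop m (\<phi> n) s) \<longlonglongrightarrow> Aop m W s"
    using Ccone_Aop_limit[OF assms(1)] by auto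
  show ?thesis
    by (rule LIMSEQ_le_const[OF lim[OF assms(2)]]) (simp add: Aop_nonneg C0_nonneg[OF phi])
qed

lemma Ccone_Aop_le_center:
  assumes "W \<in> Ccone"
  shows "Aop 1 W s \<le> Aop 1 W 0"
proof -
  obtain \<phi> where phi: "\<And>n. \<phi> n \<in> C0" and lim: "\<And>m s. 0 < m \<Longrightarrow> (\<lambda>n. Aop m (\<phi> n) s) \<longlonglongrightarrow> Aop m W s"
    using Ccone_Aop_limit[OF assms] by auto
  show ?thesis
    by (rule LIMSEQ_le[OF lim[of 1 s] lim[of 1 0]])
       (use C0_Aop_le_center[OF phi] in \<open>simp_all del: One_nat_def\<close>)
qed

section \<open>Smooth approximation of the indicator\<close>

text \<open>By induction all iterated derivatives stay in \<open>X\<close>, so no formula for the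
  derivative of order \<open>k\<close> is required.\<close>

lemma smooth_if_closed_under_derivatives:
  assumes closed: "\<And>f. f \<in> X \<Longrightarrow> \<exists>f'\<in>X. \<forall>x. (f has_field_derivative f' x) (at x)"
    and "f \<in> X"
  shows "smooth f"
proof -
  have "(deriv ^^ k) f \<in> X" for k
  proof (induction k)
    case (Suc k)
    obtain f' where f': "f' \<in> X" "\<And>x. ((deriv ^^ k) f has_field_derivative f' x) (at x)"
      using closed[OF Suc] by blast
    then have "deriv ((deriv ^^ k) f) = f'" by (intro ext DERIV_imp_deriv)
    with f' show ?case by simp
  qed (simp add: assms)
  then show ?thesis
    unfolding smooth_def real_differentiable_def using closed by fast
qed

text \<open>One term of the exponential series is at most the whole. With \<open>y = 1/u\<close>
  this says that \<open>exp (-1/u)\<close> decays faster than any power of \<open>u\<close>.\<close>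

lemma exp_ge_power_over_fact:
  fixes y :: real
  assumes "0 \<le> y"
  shows "y ^ n / fact n \<le> exp y"
proof -
  have "(\<Sum>i\<in>{n}. y ^ i /\<^sub>R fact i) \<le> (\<Sum>i. y ^ i /\<^sub>R fact i)"
    using assms by (intro sum_le_suminf summable_exp_generic) auto
  then show ?thesis by (simp add: exp_def divide_inverse mult.commute)
qed

text \<open>For a fixed polynomial \<open>U\<close>, the functions \<open>p U\<^bsup>-k\<^esup> exp (-1/U)\<close>, cut off to zero where
  \<open>U \<le> 0\<close>, form a family closed under differentiation; hence all of them are smooth.\<close>

definition flat :: "real poly \<Rightarrow> real poly \<Rightarrow> nat \<Rightarrow> real \<Rightarrow> real" where
  "flat U p k x = (if 0 < poly U x then poly p x / poly U x ^ k * exp (- (1 / poly U x)) else 0)"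

text \<open>The numerator in the derivative of \<open>p / U^k * exp (-1/U)\<close> over the common
  denominator \<open>U^(k+2)\<close>.\<close>

definition flat_num :: "real poly \<Rightarrow> real poly \<Rightarrow> nat \<Rightarrow> real poly" where
  "flat_num U p k = pderiv p * U\<^sup>2 - smult (real k) (p * pderiv U * U) + p * pderiv U"

text \<open>The exponential estimate of order \<open>k + 2\<close> cancels the denominator
  \<open>U^k\<close> and leaves \<open>U^2\<close>, enough to force a zero derivative where
  \<open>U\<close> vanishes.\<close>

lemma flat_abs_le: "\<bar>flat U p k x\<bar> \<le> \<bar>fact (k + 2) * poly p x * (poly U x)\<^sup>2\<bar>"
proof (cases "0 < poly U x")
  case True
  define u where "u = poly U x"
  define F :: real where "F = fact (k + 2)"
  have u: "0 < u" using True by (simp add: u_def)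
  have F: "0 < F" by (simp add: F_def)
  have "(1 / u) ^ (k + 2) / F \<le> exp (1 / u)"
    unfolding F_def by (rule exp_ge_power_over_fact) (use u in simp)
  then have "1 \<le> exp (1 / u) * F * (u ^ k * u\<^sup>2)"
    using u F by (simp add: power_one_over power_add power2_eq_square divide_le_eq mult_ac)
  then have "1 / u ^ k * exp (- (1 / u)) \<le> F * u\<^sup>2"
    using u by (simp add: exp_minus field_simps)
  then have "\<bar>poly p x\<bar> * (1 / u ^ k * exp (- (1 / u))) \<le> \<bar>poly p x\<bar> * (F * u\<^sup>2)"
    by (rule mult_left_mono) simp
  then have "\<bar>flat U p k x\<bar> \<le> \<bar>F * poly p x * u\<^sup>2\<bar>"
    using u F by (simp add: flat_def u_def[symmetric] abs_mult mult_ac)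
  then show ?thesis by (simp only: F_def u_def)
qed (simp add: flat_def)

text \<open>The case split on \<open>k\<close> is due to the truncated exponent
  \<open>k - 1\<close>.\<close>

lemma flat_quotient_rule:
  fixes u :: real
  assumes "u \<noteq> 0"
  shows "(p' * u ^ k - p * (real k * u ^ (k - 1) * u')) / (u ^ k * u ^ k) * E + p / u ^ k * (E * (u' / u\<^sup>2))
    = (p' * u\<^sup>2 - real k * (p * u' * u) + p * u') / u ^ (k + 2) * E"
proof (cases k)
  case (Suc j)
  then show ?thesis using assms by (simp add: field_simps power2_eq_square)
qed (use assms in \<open>simp add: field_simps power2_eq_square\<close>)

lemma flat_has_derivative:
  "(flat U p k has_field_derivative flat U (flat_num U p k) (k + 2) x) (at x)"
proof -
  consider "0 < poly U x" | "poly U x < 0" | "poly U x = 0" by linarith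
  then show ?thesis
  proof cases
    case 1
    let ?f = "\<lambda>x. poly p x / poly U x ^ k * exp (- (1 / poly U x))"
    have "(?f has_field_derivative flat U (flat_num U p k) (k + 2) x) (at x)"
    proof -
      have "((\<lambda>x. poly p x / poly U x ^ k) has_field_derivative
          (poly (pderiv p) x * poly U x ^ k - poly p x * (real k * poly U x ^ (k - 1) * poly (pderiv U) x))
            / (poly U x ^ k * poly U x ^ k)) (at x)"
        using 1 by (auto intro!: derivative_eq_intros)
      moreover have "((\<lambda>x. exp (- (1 / poly U x))) has_field_derivative
          exp (- (1 / poly U x)) * (poly (pderiv U) x / (poly U x)\<^sup>2)) (at x)"
        using 1 by (auto intro!: derivative_eq_intros simp: power2_eq_square)
      ultimately have "(?f has_field_derivative
          (poly (pderiv p) x * poly U x ^ k - poly p x * (real k * poly U x ^ (k - 1) * poly (pderiv U) x))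
            / (poly U x ^ k * poly U x ^ k) * exp (- (1 / poly U x))
          + poly p x / poly U x ^ k * (exp (- (1 / poly U x)) * (poly (pderiv U) x / (poly U x)\<^sup>2))) (at x)"
        by (rule DERIV_cong[OF DERIV_mult]) (simp only: mult.commute)
      then show ?thesis
        using 1 unfolding flat_quotient_rule[OF less_imp_neq[OF 1, symmetric]]
        by (simp add: flat_def flat_num_def)
    qed
    then show ?thesis
    proof (rule has_field_derivative_transform_within_open)
      show "open {x. 0 < poly U x}" by (intro open_Collect_less continuous_intros)
    qed (use 1 in \<open>simp_all add: flat_def\<close>)
  next
    case 2
    have "((\<lambda>_. 0) has_field_derivative 0) (at x)" by simp
    then have "(flat U p k has_field_derivative 0) (at x)"
    proof (rule has_field_derivative_transform_within_open)
      show "open {x. poly U x < 0}" by (intro open_Collect_less continuous_intros)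
    qed (use 2 in \<open>simp_all add: flat_def\<close>)
    then show ?thesis using 2 by (simp add: flat_def)
  next
    case 3
    \<comment> \<open>\<open>U\<close> vanishes at \<open>x\<close>, so the polynomial
      \<open>?H\<close> has a zero of order at least two there; its difference quotient tends to 0
      and dominates that of \<open>flat\<close>.\<close>
    let ?H = "\<lambda>y. fact (k + 2) * poly p y * (poly U y)\<^sup>2"
    have "(?H has_field_derivative 0) (at x)"
      using 3 by (auto intro!: derivative_eq_intros)
    then have H: "((\<lambda>y. ?H y / (y - x)) \<longlongrightarrow> 0) (at x)"
      using 3 by (simp add: has_field_derivative_iff)
    have "((\<lambda>y. flat U p k y / (y - x)) \<longlongrightarrow> 0) (at x)"
    proof (rule Lim_null_comparison[OF _ tendsto_rabs_zero[OF H]])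
      show "\<forall>\<^sub>F y in at x. norm (flat U p k y / (y - x)) \<le> \<bar>?H y / (y - x)\<bar>"
        using flat_abs_le[of U p k] by (intro always_eventually allI) (simp add: abs_divide divide_right_mono)
    qed
    then show ?thesis using 3 by (simp add: has_field_derivative_iff flat_def)
  qed
qed

lemma smooth_flat: "smooth (flat U p k)"
proof (rule smooth_if_closed_under_derivatives[of "{flat U p k |p k. True}"])
  show "\<exists>f'\<in>{flat U p k |p k. True}. \<forall>x. (f has_field_derivative f' x) (at x)"
    if "f \<in> {flat U p k |p k. True}" for f
    using that flat_has_derivative by blast
qed blast

lemma abs_less_half_iff: "\<bar>x\<bar> < 1/2 \<longleftrightarrow> 0 < 1 - 4 * x\<^sup>2" for x :: real
  using abs_square_less_1[of "2 * x"] by (auto simp: power_mult_distrib)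

text \<open>Here \<open>U\<close> is \<open>(n + 1) * (1 - 4 * x^2)\<close>, positive exactly on the
  open interval of radius 1/2. The factor \<open>n + 1\<close> drives the exponential to 1 there, so
  the bumps tend to \<open>c\<close> times the indicator without leaving its support.\<close>

definition bump :: "real \<Rightarrow> nat \<Rightarrow> real \<Rightarrow> real" where
  "bump c n = flat [:real (Suc n), 0, -4 * real (Suc n):] [:c:] 0"

lemma bump_eq: "bump c n x = (if \<bar>x\<bar> < 1/2 then c * exp (- (1 / (1 - 4 * x\<^sup>2)) * inverse (real (Suc n))) else 0)"
proof -
  have p: "poly [:real (Suc n), 0, -4 * real (Suc n):] x = real (Suc n) * (1 - 4 * x\<^sup>2)"
    by (simp add: power2_eq_square algebra_simps)
  have "0 < real (Suc n) * (1 - 4 * x\<^sup>2) \<longleftrightarrow> \<bar>x\<bar> < 1/2"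
    unfolding abs_less_half_iff by (simp add: zero_less_mult_iff)
  moreover have "- (1 / (real (Suc n) * (1 - 4 * x\<^sup>2))) = - (1 / (1 - 4 * x\<^sup>2)) * inverse (real (Suc n))"
    by (simp add: divide_inverse)
  moreover have "poly [:c:] x / y ^ 0 = c" for y :: real by simp
  ultimately show ?thesis
    unfolding bump_def flat_def p by (simp only:)
qed

text \<open>For a constant numerator and \<open>k = 0\<close>, only the term
  \<open>p * pderiv U\<close> of \<open>flat_num\<close> survives.\<close>

lemma bump_deriv: "deriv (bump c n) x = (if \<bar>x\<bar> < 1/2 then
    c * (- 8 * real (Suc n) * x) / (real (Suc n) * (1 - 4 * x\<^sup>2))\<^sup>2 * exp (- (1 / (real (Suc n) * (1 - 4 * x\<^sup>2)))) else 0)"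
proof -
  let ?U = "[:real (Suc n), 0, -4 * real (Suc n):]"
  have p: "poly ?U x = real (Suc n) * (1 - 4 * x\<^sup>2)"
    by (simp add: power2_eq_square algebra_simps)
  have q: "poly (flat_num ?U [:c:] 0) x = c * (- 8 * real (Suc n) * x)"
    by (simp add: flat_num_def pderiv_pCons algebra_simps)
  have "deriv (bump c n) x = flat ?U (flat_num ?U [:c:] 0) (0 + 2) x"
    unfolding bump_def by (rule DERIV_imp_deriv[OF flat_has_derivative])
  then show ?thesis
    unfolding flat_def p q abs_less_half_iff
    by (simp add: zero_less_mult_iff power2_eq_square del: of_nat_Suc)
qed

lemma bump_C0:
  assumes "0 \<le> c"
  shows "bump c n \<in> C0"
proof -
  have "{x. bump c n x \<noteq> 0} \<subseteq> {-1/2..1/2}" by (auto simp: bump_eq abs_less_iff split: if_splits)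
  then have "bounded {x. bump c n x \<noteq> 0}" by (rule bounded_subset[rotated]) simp
  then have "compact_support (bump c n)"
    by (simp add: compact_support_def compact_closure)
  moreover have "smooth (bump c n)" unfolding bump_def by (rule smooth_flat)
  moreover have "\<forall>x\<ge>0. bump c n x = bump c n (-x) \<and> 0 \<le> bump c n x
      \<and> deriv (bump c n) x = - deriv (bump c n) (-x) \<and> deriv (bump c n) x \<le> 0"
  proof (intro allI impI conjI)
    fix x :: real assume "0 \<le> x"
    show "bump c n x = bump c n (-x)" "0 \<le> bump c n x"
      "deriv (bump c n) x = - deriv (bump c n) (-x)"
      using assms by (simp_all add: bump_eq bump_deriv)
    have "c * (- 8 * real (Suc n) * x) \<le> 0"
      using assms \<open>0 \<le> x\<close> by (intro mult_nonneg_nonpos mult_nonpos_nonneg) auto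
    then show "deriv (bump c n) x \<le> 0"
      unfolding bump_deriv by (simp add: divide_nonpos_nonneg mult_nonpos_nonneg del: of_nat_Suc)
  qed
  ultimately show ?thesis unfolding C0_def mem_Collect_eq by (intro conjI)
qed

lemma is_L2_indicator: "is_L2 (\<lambda>x. c * indicator {a..b} x)"
proof -
  have "integrable lborel (\<lambda>x. c\<^sup>2 * indicator {a..b} x)"
    by (intro Bochner_Integration.integrable_mult_right integrable_indicator_Icc)
  also have "(\<lambda>x. c\<^sup>2 * indicator {a..b} x) = (\<lambda>x. (c * indicator {a..b} x)\<^sup>2)"
    by (auto simp: indicator_def)
  finally show ?thesis by (simp add: is_L2_def)
qed

lemma indicator_Ccone:
  assumes "0 \<le> c"
  shows "(\<lambda>x. c * indicator {-1/2..1/2} x) \<in> Ccone"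
proof -
  let ?W = "\<lambda>x. c * indicator {-1/2..1/2::real} x"
  have m: "bump c n \<in> borel_measurable borel" for n
    unfolding bump_eq[abs_def] by measurable
  have "(\<lambda>n. \<integral>x. (bump c n x - ?W x)\<^sup>2 \<partial>lborel) \<longlonglongrightarrow> integral\<^sup>L lborel (\<lambda>x::real. 0)"
  proof (rule integral_dominated_convergence[where w = "\<lambda>x. (?W x)\<^sup>2"])
    show "integrable lborel (\<lambda>x. (?W x)\<^sup>2)" using is_L2_indicator by (simp add: is_L2_def)
    show "AE x in lborel. (\<lambda>n. (bump c n x - ?W x)\<^sup>2) \<longlonglongrightarrow> 0"
      \<comment> \<open>At the two endpoints the bumps vanish while the indicator is 1; these points
        form a null set.\<close>
      using AE_lborel_singleton[of "1/2"] AE_lborel_singleton[of "-1/2"]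
    proof eventually_elim
      case (elim x)
      consider "\<bar>x\<bar> < 1/2" | "1/2 < \<bar>x\<bar>" using elim by linarith
      then show ?case
      proof cases
        case 1
        have lim: "(\<lambda>n. (c * exp (- (1 / (1 - 4 * x\<^sup>2)) * inverse (real (Suc n))) - c)\<^sup>2)
            \<longlonglongrightarrow> (c * exp (- (1 / (1 - 4 * x\<^sup>2)) * 0) - c)\<^sup>2"
          by (intro tendsto_intros LIMSEQ_inverse_real_of_nat)
        have "indicator {-1/2..1/2} x = (1::real)" using 1 by (auto simp: indicator_def abs_less_iff)
        then have eq: "bump c n x - ?W x = c * exp (- (1 / (1 - 4 * x\<^sup>2)) * inverse (real (Suc n))) - c" for n
          unfolding bump_eq using 1 by (simp only: if_True mult_1_right)
        have z: "(c * exp (- (1 / (1 - 4 * x\<^sup>2)) * 0) - c)\<^sup>2 = 0" by simp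
        show ?thesis using lim unfolding eq z .
      next
        case 2
        then have "bump c n x - ?W x = 0" for n by (auto simp: bump_eq indicator_def)
        then show ?thesis by simp
      qed
    qed
    show "AE x in lborel. norm ((bump c n x - ?W x)\<^sup>2) \<le> (?W x)\<^sup>2" for n
    proof (rule AE_I2)
      fix x
      have "c * exp (- (1 / (1 - 4 * x\<^sup>2)) * inverse (real (Suc n))) \<le> c" if "\<bar>x\<bar> < 1/2"
      proof -
        have "0 < 1 - 4 * x\<^sup>2"
          using that by (simp only: abs_less_half_iff)
        then show ?thesis using assms by (intro mult_left_le) auto
      qed
      then have "\<bar>bump c n x - ?W x\<bar> \<le> \<bar>?W x\<bar>"
        using assms by (auto simp: bump_eq indicator_def abs_less_iff)
      then show "norm ((bump c n x - ?W x)\<^sup>2) \<le> (?W x)\<^sup>2"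
        by (simp add: abs_le_square_iff)
    qed
  qed (use m in measurable)
  then have "(\<lambda>n. L2norm (\<lambda>x. bump c n x - ?W x)) \<longlonglongrightarrow> 0"
    unfolding L2norm_def by (drule_tac tendsto_real_sqrt) simp
  then show ?thesis
    using bump_C0[OF assms] is_L2_indicator by (auto simp: Ccone_def)
qed

section \<open>The high-energy limit\<close>

text \<open>The product \<open>q * q powr (-s)\<close> is \<open>q powr (1 - s)\<close>, with
  negative exponent, while \<open>b\<close> contributes a bounded amount. The factor
  \<open>2 * q\<close> will be the length of the interval \<open>{-q..q}\<close>; the lemma is used
  with \<open>s = \<alpha>\<close> for the energy and with \<open>s = \<alpha> + 1\<close> for the
  gradient.\<close>

lemma powr_blowup:
  fixes a b s :: real
  assumes "0 < a" "1 < s"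
  shows "filterlim (\<lambda>q. 2 * q * (a * q powr (-s) - b)) at_top (at_right 0)"
proof (rule filterlim_at_top_mono)
  have s: "1 - s < 0" using assms by simp
  have "filterlim (\<lambda>q::real. q powr (1 - s)) at_top (at_right 0)"
    using s by real_asymp
  then show "filterlim (\<lambda>q. - (2 * \<bar>b\<bar>) + (2 * a) * q powr (1 - s)) at_top (at_right 0)"
    using assms by (intro filterlim_tendsto_add_at_top[OF tendsto_const]
        filterlim_tendsto_pos_mult_at_top[OF tendsto_const]) auto
  show "\<forall>\<^sub>F q in at_right 0. - (2 * \<bar>b\<bar>) + (2 * a) * q powr (1 - s) \<le> 2 * q * (a * q powr (-s) - b)"
    using eventually_at_right_real[OF zero_less_one]
  proof eventually_elim
    case (elim q)
    then have q: "0 < q" "q < 1" by auto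
    have "q * b \<le> q * \<bar>b\<bar>" using q by (intro mult_left_mono) auto
    also have "\<dots> \<le> \<bar>b\<bar>" using q by (intro mult_left_le_one_le) auto
    finally have "q * b \<le> \<bar>b\<bar>" .
    moreover have "q powr (1 - s) = q * q powr (-s)" using q by (simp add: powr_diff powr_minus_divide)
    ultimately show ?case by (simp add: algebra_simps)
  qed
qed

section \<open>Energy of profiles with prescribed kinetic energy\<close>

lemma L2norm_eq_Kin: "(L2norm W)\<^sup>2 = 2 * Kin W"
  by (simp add: L2norm_power2 Kin_def)

text \<open>The kinetic energy fixes the norm, and Cauchy-Schwarz with \<open>sqrt m \<le> m\<close>
  turns the norm into a gap.\<close>

lemma gap_profile_CK:
  assumes "0 < \<nu>" "1 < \<alpha>" "0 < \<delta>" "\<delta> < 1" and W: "W \<in> CK ((1 - \<delta>) * \<nu>\<^sup>2 / 2)"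
  shows "gap_profile \<nu> \<alpha> (1 - sqrt (1 - \<delta>)) W" and "L2norm W = \<nu> * sqrt (1 - \<delta>)"
proof -
  have C: "W \<in> Ccone" and K: "Kin W = (1 - \<delta>) * \<nu>\<^sup>2 / 2"
    using W by (auto simp: CK_def)
  have "(L2norm W)\<^sup>2 = (\<nu> * sqrt (1 - \<delta>))\<^sup>2"
    using assms by (simp add: L2norm_eq_Kin K power_mult_distrib)
  then show n: "L2norm W = \<nu> * sqrt (1 - \<delta>)"
    by (rule power2_eq_imp_eq) (use assms in auto)
  show "gap_profile \<nu> \<alpha> (1 - sqrt (1 - \<delta>)) W"
  proof
    show "Aop m W s \<le> (1 - (1 - sqrt (1 - \<delta>))) * (\<nu> * real m)" if "0 < m" for m s
    proof -
      have "sqrt (real m) \<le> real m"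
        by (rule real_le_lsqrt) (use that in \<open>auto simp: power2_eq_square\<close>)
      then have "sqrt (real m) * L2norm W \<le> real m * L2norm W" by (intro mult_right_mono) auto
      then have "Aop m W s \<le> real m * L2norm W"
        using Aop_abs_le[OF Ccone_is_L2[OF C] that, of s] by linarith
      then show ?thesis by (simp add: n mult_ac)
    qed
  qed (use assms C in \<open>auto intro: Ccone_is_L2 Ccone_Aop_nonneg\<close>)
qed

text \<open>Needed for the real supremum in \<open>Pmax\<close> to dominate the energy of a
  competitor. The bound depends on \<open>\<delta>\<close> and degenerates as
  \<open>\<delta>\<close> tends to 0.\<close>

lemma bdd_above_Pot_CK:
  assumes "0 < \<nu>" "1 < \<alpha>" "0 < \<delta>" "\<delta> < 1"
  shows "bdd_above (Pot \<nu> \<alpha> ` CK ((1 - \<delta>) * \<nu>\<^sup>2 / 2))"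
proof -
  let ?k = "1 - sqrt (1 - \<delta>)"
  have "Pot \<nu> \<alpha> W \<le> \<alpha> * (\<alpha> + 1) * (?k * \<nu>) powr (-\<alpha> - 2) * (\<nu> * sqrt (1 - \<delta>))\<^sup>2 * (\<Sum>m. real (Suc m) powr (-\<alpha>))"
    if "W \<in> CK ((1 - \<delta>) * \<nu>\<^sup>2 / 2)" for W
    using gap_profile.Pot_le[OF gap_profile_CK(1)[OF assms that]]
    unfolding gap_profile.C_def[OF gap_profile_CK(1)[OF assms that]] gap_profile_CK(2)[OF assms that] .
  then show ?thesis by (intro bdd_aboveI2)
qed

text \<open>Two unit intervals with centers at distance \<open>\<bar>s\<bar>\<close> overlap in
  length \<open>1 - \<bar>s\<bar>\<close>.\<close>

lemma Aop_indicator_ge: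
  assumes "0 \<le> c" "\<bar>s\<bar> \<le> 1"
  shows "c * (1 - \<bar>s\<bar>) \<le> Aop 1 (\<lambda>x. c * indicator {-1/2..1/2} x) s"
proof -
  have "{s - 1/2..s + 1/2} \<inter> {-1/2..1/2} = {max (s - 1/2) (-1/2)..min (s + 1/2) (1/2)}"
    by auto
  then have eq: "indicator {s - 1/2..s + 1/2} x * (c * indicator {-1/2..1/2} x)
      = c * indicator {max (s - 1/2) (-1/2)..min (s + 1/2) (1/2)} x" for x
    by (auto simp: indicator_def)
  have "Aop 1 (\<lambda>x. c * indicator {-1/2..1/2} x) s
      = (\<integral>x. indicator {s - 1/2..s + 1/2} x * (c * indicator {-1/2..1/2} x) \<partial>lborel)"
    unfolding Aop_eq set_lebesgue_integral_def by (simp only: real_scaleR_def of_nat_1)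
  also have "\<dots> = (\<integral>x. c * indicator {max (s - 1/2) (-1/2)..min (s + 1/2) (1/2)} x \<partial>lborel)"
    by (simp only: eq)
  also have "\<dots> = c * measure lborel {max (s - 1/2) (-1/2)..min (s + 1/2) (1/2)}"
    by simp
  also have "measure lborel {max (s - 1/2) (-1/2)..min (s + 1/2) (1/2)} = 1 - \<bar>s\<bar>"
    using assms by (subst measure_lborel_Icc) (auto simp: max_def min_def)
  finally show ?thesis by simp
qed

text \<open>On \<open>{-q..q}\<close> the average of \<open>T\<close> lies within
  \<open>2 * q * \<nu>\<close> of the singularity, so the term \<open>m = 1\<close> alone,
  integrated over this interval of length \<open>2 * q\<close>, gives the bound.\<close>

lemma Pot_indicator_ge:
  fixes \<nu> \<alpha> \<delta> :: real
  assumes "0 < \<nu>" "1 < \<alpha>" "0 < \<delta>" "\<delta> < 1"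
  defines "q \<equiv> 1 - sqrt (1 - \<delta>)"
  defines "T \<equiv> \<lambda>x. \<nu> * sqrt (1 - \<delta>) * indicator {-1/2..1/2} x"
  shows "T \<in> CK ((1 - \<delta>) * \<nu>\<^sup>2 / 2)"
    and "2 * q * ((2 * q * \<nu>) powr (-\<alpha>) - (1 + \<alpha>) * \<nu> powr (-\<alpha>)) \<le> Pot \<nu> \<alpha> T"
proof -
  let ?b = "(2 * q * \<nu>) powr (-\<alpha>) - (1 + \<alpha>) * \<nu> powr (-\<alpha>)"
  have q: "0 < q" "q < 1" using assms by (auto simp: q_def)
  have Tq: "T = (\<lambda>x. \<nu> * (1 - q) * indicator {-1/2..1/2} x)" by (simp add: T_def q_def)
  have "(\<lambda>x. (T x)\<^sup>2) = (\<lambda>x. \<nu>\<^sup>2 * (1 - \<delta>) * indicator {-1/2..1/2} x)"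
    using assms by (auto simp: T_def indicator_def power_mult_distrib)
  then have "Kin T = (1 - \<delta>) * \<nu>\<^sup>2 / 2" by (simp add: Kin_def)
  moreover have "T \<in> Ccone" unfolding T_def using assms by (intro indicator_Ccone) auto
  ultimately show CK: "T \<in> CK ((1 - \<delta>) * \<nu>\<^sup>2 / 2)" by (simp add: CK_def)
  interpret gap_profile \<nu> \<alpha> q T
    unfolding q_def by (rule gap_profile_CK(1)[OF assms(1-4) CK])
  have "2 * q * ?b = (\<integral>s. indicator {-q..q} s * ?b \<partial>lborel)"
    using q by simp
  also have "\<dots> \<le> (\<integral>s. Psi \<nu> \<alpha> 1 (Aop 1 T s) \<partial>lborel)"
  proof (rule integral_mono)
    show "integrable lborel (\<lambda>s. indicator {-q..q} s * ?b)"
      by (intro Bochner_Integration.integrable_mult_left integrable_indicator_Icc)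
    show "integrable lborel (\<lambda>s. Psi \<nu> \<alpha> 1 (Aop 1 T s))"
      using integrable_Psi_Aop[of 0] by simp
    show "indicator {-q..q} s * ?b \<le> Psi \<nu> \<alpha> 1 (Aop 1 T s)" for s
    proof (cases "\<bar>s\<bar> \<le> q")
      case True
      let ?r = "Aop 1 T s"
      have r: "?r \<le> (1 - q) * \<nu>" using Aop_le[of 1 s] by simp
      \<comment> \<open>One factor \<open>1 - q\<close> is the height of \<open>T\<close> relative
        to \<open>\<nu>\<close>, the other bounds the overlap; \<open>q^2\<close> is
        dropped.\<close>
      have "(1 - 2 * q) * \<nu> \<le> (1 - q) * (1 - q) * \<nu>"
        using nu by (intro mult_right_mono) (auto simp: algebra_simps)
      also have "\<dots> \<le> \<nu> * (1 - q) * (1 - \<bar>s\<bar>)"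
        using True nu q by (simp add: mult_left_mono mult_ac)
      also have "\<dots> \<le> ?r"
        unfolding Tq using True q nu by (intro Aop_indicator_ge) auto
      finally have r2: "\<nu> - ?r \<le> 2 * q * \<nu>" by (simp add: algebra_simps)
      have "0 < q * \<nu>" using q nu by simp
      then have r3: "0 < \<nu> - ?r" using r by (simp add: algebra_simps)
      have "(2 * q * \<nu>) powr (-\<alpha>) \<le> (\<nu> - ?r) powr (-\<alpha>)"
        using r2 r3 alpha by (intro powr_mono2') auto
      \<comment> \<open>Bounding the linear term of \<open>Psi\<close> at \<open>r = \<nu>\<close>
        produces the coefficient \<open>1 + \<alpha>\<close>.\<close>
      moreover have "\<alpha> * \<nu> powr (-\<alpha> - 1) * ?r \<le> \<alpha> * \<nu> powr (-\<alpha> - 1) * \<nu>"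
        using r3 alpha by (intro mult_left_mono) auto
      moreover have "\<nu> powr (-\<alpha> - 1) * \<nu> = \<nu> powr (-\<alpha>)"
        using nu by (simp add: powr_diff)
      ultimately have "?b \<le> Psi \<nu> \<alpha> 1 ?r" by (simp add: Psi_def algebra_simps)
      then show ?thesis using True by (auto simp: indicator_def abs_le_iff)
    next
      case False
      then have "indicator {-q..q} s = (0::real)" by (auto simp: indicator_def abs_le_iff)
      then show ?thesis using Psi_Aop_nonneg[of 0 s] by simp
    qed
  qed
  also have "\<dots> \<le> Pot \<nu> \<alpha> T" by (rule Pot_ge_first)
  finally show "2 * q * ?b \<le> Pot \<nu> \<alpha> T" .
qed

text \<open>For \<open>m = 1\<close> the central average is the largest one. For
  \<open>m \<ge> 2\<close> Cauchy-Schwarz already leaves the relative gap 1/4, whence the condition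
  \<open>e \<le> 1/4\<close>.\<close>

lemma gap_profile_if_center_small:
  assumes "0 < \<nu>" "1 < \<alpha>" "0 < e" "e \<le> 1/4" and C: "W \<in> Ccone"
    and n: "L2norm W \<le> \<nu>" and center: "Aop 1 W 0 \<le> (1 - e) * \<nu>"
  shows "gap_profile \<nu> \<alpha> e W"
proof
  show "Aop m W s \<le> (1 - e) * (\<nu> * real m)" if "0 < m" for m s
  proof (cases "m = 1")
    case True
    then show ?thesis using Ccone_Aop_le_center[OF C, of s] center by simp
  next
    case False
    \<comment> \<open>After squaring this asks for \<open>m \<ge> 16/9\<close>.\<close>
    have "sqrt (real m) \<le> 3/4 * real m"
    proof (rule real_le_lsqrt)
      have "2 * real m \<le> real m * real m" using that False by (intro mult_right_mono) auto
      then show "real m \<le> (3/4 * real m)\<^sup>2" by (simp add: power2_eq_square)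
    qed auto
    also have "\<dots> \<le> (1 - e) * real m" using assms by (intro mult_right_mono) auto
    finally have "sqrt (real m) * L2norm W \<le> (1 - e) * real m * \<nu>"
      using n by (intro mult_mono) (use assms in auto)
    then show ?thesis using Aop_abs_le[OF Ccone_is_L2[OF C] that, of s] by (simp add: mult_ac)
  qed
qed (use assms in \<open>auto intro: Ccone_is_L2 Ccone_Aop_nonneg\<close>)

text \<open>Expand the square: the window of the central average is the support of the indicator, so
  the cross term is exactly \<open>2 * \<nu> * Aop 1 W 0\<close>.\<close>

lemma L2norm_diff_indicator_le:
  assumes W: "is_L2 W" and "0 < \<nu>" "L2norm W \<le> \<nu>" and "(1 - e) * \<nu> \<le> Aop 1 W 0"
  shows "(L2norm (\<lambda>x. W x - \<nu> * indicator {-1/2..1/2} x))\<^sup>2 \<le> 2 * e * \<nu>\<^sup>2"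
proof -
  let ?I = "{-1/2..1/2::real}"
  have i1: "integrable lborel (\<lambda>x. (W x)\<^sup>2)" using W by (simp add: is_L2_def)
  have i2: "integrable lborel (\<lambda>x. indicator ?I x * W x)"
    using is_L2_set_integrable[OF W] by (simp add: set_integrable_def)
  have i3: "integrable lborel (\<lambda>x. indicator ?I x :: real)"
    by (rule integrable_indicator_Icc)
  have "(L2norm (\<lambda>x. W x - \<nu> * indicator ?I x))\<^sup>2
      = (\<integral>x. (W x)\<^sup>2 - 2 * \<nu> * (indicator ?I x * W x) + \<nu>\<^sup>2 * indicator ?I x \<partial>lborel)"
    unfolding L2norm_power2
    by (intro Bochner_Integration.integral_cong) (auto simp: indicator_def power2_eq_square algebra_simps)
  also have "\<dots> = (L2norm W)\<^sup>2 - 2 * \<nu> * (\<integral>x. indicator ?I x * W x \<partial>lborel) + \<nu>\<^sup>2"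
    using i1 i2 i3 by (simp add: L2norm_power2)
  also have "(\<integral>x. indicator ?I x * W x \<partial>lborel) = Aop 1 W 0"
    by (simp add: Aop_eq set_lebesgue_integral_def)
  also have "(L2norm W)\<^sup>2 - 2 * \<nu> * Aop 1 W 0 + \<nu>\<^sup>2 \<le> \<nu>\<^sup>2 - 2 * \<nu> * ((1 - e) * \<nu>) + \<nu>\<^sup>2"
    using assms by (intro add_mono diff_mono mult_left_mono power_mono) auto
  finally show ?thesis by (simp add: power2_eq_square algebra_simps)
qed

text \<open>Closeness in norm makes the averages for \<open>m = 1\<close> uniformly close, so they
  are within \<open>(\<nu> + 1) * e\<close> of \<open>\<nu>\<close> on \<open>{-e..e}\<close>. The
  outer average collects the resulting peak of \<open>dPsi\<close> at every \<open>\<xi>\<close> in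
  \<open>{-1/4..1/4}\<close>. The bound is independent of the gap \<open>k\<close>, so it persists
  as the gap closes.\<close>

lemma (in gap_profile) L2norm_dPot_ge:
  assumes e: "0 < e" "e \<le> 1/4" and near: "L2norm (\<lambda>x. W x - \<nu> * indicator {-1/2..1/2} x) \<le> e"
    and B: "0 \<le> B" "B \<le> 2 * e * (\<alpha> * ((\<nu> + 1) * e) powr (-\<alpha> - 1) - \<alpha> * \<nu> powr (-\<alpha> - 1))"
  shows "B \<le> 2 * L2norm (dPot \<nu> \<alpha> W)"
proof -
  let ?W0 = "\<lambda>x. \<nu> * indicator {-1/2..1/2::real} x"
  let ?g = "\<lambda>s. dPsi \<nu> \<alpha> 1 (Aop 1 W s)"
  let ?b = "\<alpha> * ((\<nu> + 1) * e) powr (-\<alpha> - 1) - \<alpha> * \<nu> powr (-\<alpha> - 1)"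
  have g: "?b \<le> ?g s" if "\<bar>s\<bar> \<le> e" for s
  proof -
    have "\<bar>Aop 1 W s - Aop 1 ?W0 s\<bar> \<le> e"
      using Aop_abs_le[OF is_L2_diff[OF L2 is_L2_indicator], of 1 \<nu> "-1/2" "1/2" s] near
      by (simp add: Aop_diff[OF L2 is_L2_indicator])
    moreover have "\<nu> * (1 - \<bar>s\<bar>) \<le> Aop 1 ?W0 s"
      using that e nu by (intro Aop_indicator_ge) auto
    moreover have "\<nu> * (1 - e) \<le> \<nu> * (1 - \<bar>s\<bar>)" using that nu by (intro mult_left_mono) auto
    ultimately have r: "\<nu> - Aop 1 W s \<le> (\<nu> + 1) * e" by (simp add: algebra_simps abs_le_iff)
    have "0 < k * \<nu>" using k nu by simp
    then have "0 < \<nu> - Aop 1 W s" using Aop_le[of 1 s] by (simp add: algebra_simps)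
    with r have "((\<nu> + 1) * e) powr (-\<alpha> - 1) \<le> (\<nu> - Aop 1 W s) powr (-\<alpha> - 1)"
      using alpha by (intro powr_mono2') auto
    then show ?thesis using alpha by (simp add: dPsi_def mult_left_mono)
  qed
  have g0: "0 \<le> ?g s" for s using dPsi_Aop_nonneg[of 0 s] by simp
  have h0: "B \<le> dPot_term 0 \<xi>" if "\<bar>\<xi>\<bar> \<le> 1/4" for \<xi>
  proof -
    have "2 * e * ?b = (\<integral>s. indicator {-e..e} s * ?b \<partial>lborel)" using e by simp
    also have "\<dots> \<le> (\<integral>s. indicator {\<xi> - 1/2..\<xi> + 1/2} s * ?g s \<partial>lborel)"
    proof (rule integral_mono)
      show "integrable lborel (\<lambda>s. indicator {-e..e} s * ?b)"
        by (intro Bochner_Integration.integrable_mult_left integrable_indicator_Icc)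
      show "integrable lborel (\<lambda>s. indicator {\<xi> - 1/2..\<xi> + 1/2} s * ?g s)"
        using is_L2_set_integrable[OF dPsi_Aop_L2[of 0]] by (simp add: set_integrable_def)
      show "indicator {-e..e} s * ?b \<le> indicator {\<xi> - 1/2..\<xi> + 1/2} s * ?g s" for s
      proof (cases "\<bar>s\<bar> \<le> e")
        case True
        \<comment> \<open>Both \<open>\<bar>s\<bar>\<close> and \<open>\<bar>\<xi>\<bar>\<close> are
          at most 1/4, so \<open>s\<close> stays in the unit window around
          \<open>\<xi>\<close>.\<close>
        then have "s \<in> {-e..e}" "s \<in> {\<xi> - 1/2..\<xi> + 1/2}" using that e by (auto simp: abs_le_iff)
        then show ?thesis using g[OF True] by simp
      next
        case False
        then have "indicator {-e..e} s = (0::real)" by (auto simp: indicator_def abs_le_iff)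
        then show ?thesis using g0[of s] by simp
      qed
    qed
    also have "\<dots> = dPot_term 0 \<xi>" by (simp add: dPot_term_def Aop_eq set_lebesgue_integral_def)
    finally show ?thesis using B by linarith
  qed
  have "B\<^sup>2 / 2 = (\<integral>\<xi>. indicator {-1/4..1/4::real} \<xi> * B\<^sup>2 \<partial>lborel)" by simp
  also have "\<dots> \<le> (\<integral>\<xi>. (dPot \<nu> \<alpha> W \<xi>)\<^sup>2 \<partial>lborel)"
  proof (rule integral_mono)
    show "integrable lborel (\<lambda>\<xi>. indicator {-1/4..1/4::real} \<xi> * B\<^sup>2)"
      by (intro Bochner_Integration.integrable_mult_left integrable_indicator_Icc)
    show "integrable lborel (\<lambda>\<xi>. (dPot \<nu> \<alpha> W \<xi>)\<^sup>2)" using dPot_L2 by (simp add: is_L2_def)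
    show "indicator {-1/4..1/4} \<xi> * B\<^sup>2 \<le> (dPot \<nu> \<alpha> W \<xi>)\<^sup>2" for \<xi> :: real
    proof (cases "\<bar>\<xi>\<bar> \<le> 1/4")
      case True
      then have "B \<le> dPot \<nu> \<alpha> W \<xi>" using h0[OF True] dPot_ge_first[of \<xi>] by linarith
      then show ?thesis using B(1) by (simp add: indicator_def power_mono)
    qed (auto simp: indicator_def abs_le_iff)
  qed
  finally have "B\<^sup>2 / 2 \<le> (L2norm (dPot \<nu> \<alpha> W))\<^sup>2" by (simp add: L2norm_power2)
  \<comment> \<open>The factor 2 is rounded up to 4, which avoids \<open>sqrt 2\<close>.\<close>
  then have "B\<^sup>2 \<le> (2 * L2norm (dPot \<nu> \<alpha> W))\<^sup>2"
    by (simp add: power_mult_distrib) (use zero_le_power2[of "L2norm (dPot \<nu> \<alpha> W)"] in linarith)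
  then show ?thesis by (rule power2_le_imp_le) simp
qed

section \<open>Convergence of the maximizers and divergence of the wave speed\<close>

theorem theorem3p2:
  fixes \<nu> \<alpha> :: real and W :: "real \<Rightarrow> real \<Rightarrow> real"
  assumes "\<nu> > 0" and "\<alpha> > 3/2"
    and "\<And>\<delta>. \<delta> \<in> {0<..<1} \<Longrightarrow> W \<delta> \<in> Ccone"
    and "\<And>\<delta>. \<delta> \<in> {0<..<1} \<Longrightarrow> Kin (W \<delta>) = (1 - \<delta>) * \<nu>\<^sup>2 / 2"
    and "\<And>\<delta>. \<delta> \<in> {0<..<1} \<Longrightarrow> Pot \<nu> \<alpha> (W \<delta>) = Pmax \<nu> \<alpha> ((1 - \<delta>) * \<nu>\<^sup>2 / 2)"
  shows "((\<lambda>\<delta>. L2norm (\<lambda>x. W \<delta> x - \<nu> * indicator {-1/2..1/2} x)) \<longlongrightarrow> 0) (at_right 0)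
       \<and> filterlim (\<lambda>\<delta>. (mu \<nu> \<alpha> (W \<delta>) powr (-1/2))\<^sup>2) at_top (at_right 0)"
proof -
  let ?D = "\<lambda>\<delta>. L2norm (\<lambda>x. W \<delta> x - \<nu> * indicator {-1/2..1/2} x)"
  have alpha: "1 < \<alpha>" using assms(2) by simp
  have ev: "\<forall>\<^sub>F \<delta> in at_right (0::real). 0 < \<delta> \<and> \<delta> < 1"
    using eventually_at_right_real[of 0 "1::real"] by simp
  have CK: "W \<delta> \<in> CK ((1 - \<delta>) * \<nu>\<^sup>2 / 2)" if "0 < \<delta>" "\<delta> < 1" for \<delta>
    using assms(3,4)[of \<delta>] that by (simp add: CK_def)
  have norm: "0 < L2norm (W \<delta>)" "L2norm (W \<delta>) \<le> \<nu>" if "0 < \<delta>" "\<delta> < 1" for \<delta>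
  proof -
    have "L2norm (W \<delta>) = \<nu> * sqrt (1 - \<delta>)"
      by (rule gap_profile_CK(2)[OF assms(1) alpha that CK[OF that]])
    moreover have "0 < sqrt (1 - \<delta>)" "sqrt (1 - \<delta>) \<le> 1" using that by auto
    ultimately show "0 < L2norm (W \<delta>)" "L2norm (W \<delta>) \<le> \<nu>"
      using assms(1) by (auto intro: mult_left_le)
  qed

  \<comment> \<open>The energy of a maximizer is at least that of the scaled indicator, with
    \<open>?q \<delta>\<close> tending to 0 from the right.\<close>
  have "filterlim (\<lambda>\<delta>. Pot \<nu> \<alpha> (W \<delta>)) at_top (at_right 0)"
  proof (rule filterlim_at_top_mono)
    let ?q = "\<lambda>\<delta>::real. 1 - sqrt (1 - \<delta>)"
    have "filterlim ?q (at_right 0) (at_right 0)" by real_asymp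
    moreover have "filterlim (\<lambda>q. 2 * q * ((2 * q * \<nu>) powr (-\<alpha>) - (1 + \<alpha>) * \<nu> powr (-\<alpha>))) at_top (at_right 0)"
    proof (rule filterlim_cong[THEN iffD1, OF refl refl _ powr_blowup[of "(2 * \<nu>) powr (-\<alpha>)" \<alpha>]])
      show "\<forall>\<^sub>F q in at_right 0. 2 * q * ((2 * \<nu>) powr (-\<alpha>) * q powr (-\<alpha>) - (1 + \<alpha>) * \<nu> powr (-\<alpha>))
          = 2 * q * ((2 * q * \<nu>) powr (-\<alpha>) - (1 + \<alpha>) * \<nu> powr (-\<alpha>))"
        using eventually_at_right_real[OF zero_less_one]
        by eventually_elim (use assms(1) in \<open>simp add: powr_mult mult_ac\<close>)
    qed (use assms(1) alpha in auto)
    ultimately show "filterlim (\<lambda>\<delta>. 2 * ?q \<delta> * ((2 * ?q \<delta> * \<nu>) powr (-\<alpha>) - (1 + \<alpha>) * \<nu> powr (-\<alpha>))) at_top (at_right 0)"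
      by (rule filterlim_compose[rotated])
    show "\<forall>\<^sub>F \<delta> in at_right 0. 2 * ?q \<delta> * ((2 * ?q \<delta> * \<nu>) powr (-\<alpha>) - (1 + \<alpha>) * \<nu> powr (-\<alpha>)) \<le> Pot \<nu> \<alpha> (W \<delta>)"
      using ev
    proof eventually_elim
      case (elim \<delta>)
      then have d: "0 < \<delta>" "\<delta> < 1" by auto
      note T = Pot_indicator_ge[OF assms(1) alpha d]
      from cSUP_upper[OF T(1) bdd_above_Pot_CK[OF assms(1) alpha d]] T(2) assms(5)[of \<delta>] d
      show ?case by (simp add: Pmax_def)
    qed
  qed
  then have Pot_top: "\<forall>\<^sub>F \<delta> in at_right 0. Z < Pot \<nu> \<alpha> (W \<delta>)" for Z
    by (simp add: filterlim_at_top_dense)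

  \<comment> \<open>The threshold for the energy is the bound \<open>Pot_le\<close> for gap
    \<open>e\<close> and norm at most \<open>\<nu>\<close>. It does not depend on
    \<open>\<delta>\<close>, so for small \<open>\<delta>\<close> the maximizer exceeds it and
    cannot have gap \<open>e\<close>.\<close>
  have center: "\<forall>\<^sub>F \<delta> in at_right 0. (1 - e) * \<nu> \<le> Aop 1 (W \<delta>) 0" if e: "0 < e" "e \<le> 1/4" for e
    using ev Pot_top[of "\<alpha> * (\<alpha> + 1) * (e * \<nu>) powr (-\<alpha> - 2) * \<nu>\<^sup>2 * (\<Sum>m. real (Suc m) powr (-\<alpha>))"]
  proof eventually_elim
    case (elim \<delta>)
    then have d: "0 < \<delta>" "\<delta> < 1" by auto
    show ?case
    proof (rule ccontr)
      assume "\<not> ?case"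
      then interpret gap_profile \<nu> \<alpha> e "W \<delta>"
        using e d by (intro gap_profile_if_center_small assms(1,3) alpha norm) auto
      have "(L2norm (W \<delta>))\<^sup>2 \<le> \<nu>\<^sup>2" using norm[OF d] by (intro power_mono) auto
      then have "C * (L2norm (W \<delta>))\<^sup>2 * (\<Sum>m. real (Suc m) powr (-\<alpha>)) \<le> C * \<nu>\<^sup>2 * (\<Sum>m. real (Suc m) powr (-\<alpha>))"
        using C_nonneg by (intro mult_right_mono mult_left_mono suminf_nonneg summable_weights) auto
      with Pot_le elim show False by (simp add: C_def del: of_nat_Suc)
    qed
  qed

  have near: "\<forall>\<^sub>F \<delta> in at_right 0. ?D \<delta> \<le> r" if r: "0 < r" for r
  proof -
    \<comment> \<open>Chosen so that \<open>2 * e * \<nu>^2 \<le> r^2\<close>, within the range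
      where \<open>center\<close> applies.\<close>
    define e where "e = min (1/4) (r\<^sup>2 / (2 * \<nu>\<^sup>2))"
    have e: "0 < e" "e \<le> 1/4" using r assms(1) by (auto simp: e_def)
    have "2 * e * \<nu>\<^sup>2 \<le> 2 * (r\<^sup>2 / (2 * \<nu>\<^sup>2)) * \<nu>\<^sup>2"
      by (intro mult_right_mono mult_left_mono) (auto simp: e_def)
    also have "\<dots> = r\<^sup>2" using assms(1) by simp
    finally have er: "2 * e * \<nu>\<^sup>2 \<le> r\<^sup>2" .
    show ?thesis
      using ev center[OF e]
    proof eventually_elim
      case (elim \<delta>)
      then have d: "0 < \<delta>" "\<delta> < 1" by auto
      have "(?D \<delta>)\<^sup>2 \<le> 2 * e * \<nu>\<^sup>2"
        using elim norm[OF d] d by (intro L2norm_diff_indicator_le Ccone_is_L2 assms(1,3)) auto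
      with er have "(?D \<delta>)\<^sup>2 \<le> r\<^sup>2" by linarith
      then show ?case by (rule power2_le_imp_le) (use r in simp)
    qed
  qed

  have "(?D \<longlongrightarrow> 0) (at_right 0)"
  proof (rule tendstoI)
    fix r :: real assume "0 < r"
    then show "\<forall>\<^sub>F \<delta> in at_right 0. dist (?D \<delta>) 0 < r"
      using near[of "r/2"] by (auto elim!: eventually_mono)
  qed
  moreover have "filterlim (\<lambda>\<delta>. (mu \<nu> \<alpha> (W \<delta>) powr (-1/2))\<^sup>2) at_top (at_right 0)"
    unfolding filterlim_at_top_gt[where c = 0]
  proof (intro allI impI)
    \<comment> \<open>Since the squared speed is the norm of the gradient divided by that of
      \<open>W \<delta>\<close>, which is at most \<open>\<nu>\<close>, a gradient of norm at least
      \<open>\<nu> * Z\<close> suffices.\<close>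
    fix Z :: real assume Z: "0 < Z"
    let ?b = "\<lambda>e. 2 * e * (\<alpha> * ((\<nu> + 1) * e) powr (-\<alpha> - 1) - \<alpha> * \<nu> powr (-\<alpha> - 1))"
    have "filterlim (\<lambda>e. 2 * e * (\<alpha> * (\<nu> + 1) powr (-(\<alpha> + 1)) * e powr (-(\<alpha> + 1)) - \<alpha> * \<nu> powr (-\<alpha> - 1))) at_top (at_right 0)"
      using assms(1) alpha by (intro powr_blowup) auto
    then have "\<forall>\<^sub>F e in at_right 0. 2 * \<nu> * Z \<le>
        2 * e * (\<alpha> * (\<nu> + 1) powr (-(\<alpha> + 1)) * e powr (-(\<alpha> + 1)) - \<alpha> * \<nu> powr (-\<alpha> - 1))"
      unfolding filterlim_at_top by (rule spec)
    then have "\<forall>\<^sub>F e in at_right 0. 2 * \<nu> * Z \<le> ?b e"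
      using eventually_at_right_real[OF zero_less_one]
    proof eventually_elim
      case (elim e)
      then have "((\<nu> + 1) * e) powr (-\<alpha> - 1) = (\<nu> + 1) powr (-(\<alpha> + 1)) * e powr (-(\<alpha> + 1))"
        using assms(1) by (simp add: powr_mult)
      with elim show ?case by (simp only: mult.assoc)
    qed
    moreover have "\<forall>\<^sub>F e in at_right (0::real). 0 < e \<and> e < 1/4"
      using eventually_at_right_real[of 0 "1/4::real"] by simp
    ultimately have "\<forall>\<^sub>F e in at_right 0. 2 * \<nu> * Z \<le> ?b e \<and> 0 < e \<and> e < 1/4"
      by eventually_elim auto
    \<comment> \<open>A single \<open>e\<close> is fixed before \<open>\<delta>\<close> tends to 0:
      it sets the size of the gradient bound, and \<open>near\<close> then supplies the required
      closeness for all small \<open>\<delta>\<close>.\<close>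
    then obtain e where e: "2 * \<nu> * Z \<le> ?b e" "0 < e" "e < 1/4"
      using eventually_happens'[OF trivial_limit_at_right_real] by blast
    show "\<forall>\<^sub>F \<delta> in at_right 0. Z \<le> (mu \<nu> \<alpha> (W \<delta>) powr (-1/2))\<^sup>2"
      using ev near[OF e(2)]
    proof eventually_elim
      case (elim \<delta>)
      then have d: "0 < \<delta>" "\<delta> < 1" by auto
      let ?N = "L2norm (dPot \<nu> \<alpha> (W \<delta>))"
      have "2 * \<nu> * Z \<le> 2 * ?N"
        using elim e Z assms(1)
        by (intro gap_profile.L2norm_dPot_ge[OF gap_profile_CK(1)[OF assms(1) alpha d CK[OF d]]]) auto
      then have N: "\<nu> * Z \<le> ?N" by simp
      moreover have "0 < \<nu> * Z" using Z assms(1) by simp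
      ultimately have N0: "0 < ?N" by linarith
      \<comment> \<open>Positivity of the gradient norm rules out the default value 0 of division by
        zero and of \<open>powr\<close> at base 0.\<close>
      have mu: "0 < mu \<nu> \<alpha> (W \<delta>)" using N0 norm[OF d] by (simp add: mu_def)
      have "L2norm (W \<delta>) * Z \<le> \<nu> * Z" using norm[OF d] Z by (intro mult_right_mono) auto
      with N have "L2norm (W \<delta>) * Z \<le> ?N" by linarith
      then have "Z \<le> 1 / mu \<nu> \<alpha> (W \<delta>)"
        using norm[OF d] by (simp add: mu_def pos_le_divide_eq mult.commute)
      also have "1 / mu \<nu> \<alpha> (W \<delta>) = (mu \<nu> \<alpha> (W \<delta>) powr (-1/2))\<^sup>2"
        using mu by (simp add: power2_eq_square powr_add[symmetric] powr_minus_divide)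
      finally show ?case .
    qed
  qed
  ultimately show ?thesis by blast
qed

end
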